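(* Let $n\ge 1$. Then $H^1(\mathbb{Z}^n,C^*_{red}(\mathbb{Z}^n))$ is not Hausdorff, and $\dim_{\mathbb{C}}H^1(\mathbb{Z}^n,C^*_{red}(\mathbb{Z}^n))=\infty$.
   Context: For a group $G$, $\mathbb{C}G$ is the complex group ring and $L^2(G)$ is the Hilbert space of formal sums $\sum_{g\in G}a_g g$, $a_g\in\mathbb{C}$, with $\sum_g|a_g|^2<\infty$ and norm $\|\sum_g a_g g\|_2=(\sum_g|a_g|^2)^{1/2}$. $\mathbb{C}G$ acts on $L^2(G)$ by left multiplication; the operator norm of $\alpha\in\mathbb{C}G$ is $\|\alpha\|_{op}=\sup\{\|\alpha\cdot\beta\|_2:\beta\in L^2(G),\ \|\beta\|_2=1\}$, and $C^*_{red}(G)$ is the completion of $\mathbb{C}G$ in $\|\cdot\|_{op}$ (a Banach space of bounded operators on $L^2(G)$), on which $G$ acts by left multiplication. For a Banach space $M$ on which $G$ acts by continuous $\mathbb{C}$-linear transformations, $H^1(G,M)=A_G/B_G$, where $A_G$ is the set of maps $f:G\to M$ with $a\cdot f(b)-f(ab)+f(a)=0$ for all $a,b\in G$, and $B_G$ is the set of maps of the form $f(b)=b\cdot\alpha-\alpha$ for some fixed $\alpha\in M$. $A_G$ carries the topology of pointwise convergence on $G$ with respect to the norm of $M$, and $H^1(G,M)$ carries the induced quotient topology. *)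

theory Defs
  imports
    "HOL-Analysis.Analysis"
    "HOL-Library.Poly_Mapping"
    "Jordan_Normal_Form.VS_Connect"
begin

text \<open>
  Groups are written additively (class \<^class>\<open>group_add\<close>, not assumed commutative).  The group
  ring of \<open>'g\<close> over the complex numbers is the type \<open>'g \<Rightarrow>\<^sub>0 complex\<close> of finitely supported
  functions, whose multiplication in the library is convolution.
\<close>

section \<open>The Hilbert space of square-summable functions on a group\<close>

definition square_summable :: "('g \<Rightarrow> complex) \<Rightarrow> bool" where
  "square_summable f \<longleftrightarrow> (\<lambda>g. (cmod (f g))\<^sup>2) summable_on UNIV"

definition l2_norm :: "('g \<Rightarrow> complex) \<Rightarrow> real" where
  "l2_norm f = sqrt (\<Sum>\<^sub>\<infinity>g. (cmod (f g))\<^sup>2)"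

lemma L2_set_le_l2_norm:
  assumes "square_summable f" "finite F"
  shows "L2_set (\<lambda>g. cmod (f g)) F \<le> l2_norm f"
  using assms unfolding L2_set_def l2_norm_def square_summable_def
  by (intro real_sqrt_le_mono finite_sum_le_infsum) auto

lemma square_summable_boundI:
  assumes "\<And>F. finite F \<Longrightarrow> L2_set (\<lambda>g. cmod (f g)) F \<le> C"
  shows "square_summable f" "l2_norm f \<le> C"
proof -
  have C: "C \<ge> 0" using assms[of "{}"] by simp
  have bd: "(\<Sum>g\<in>F. (cmod (f g))\<^sup>2) \<le> C\<^sup>2" if "finite F" for F
    using assms[OF that] C unfolding L2_set_def
    by (metis real_sqrt_le_iff real_sqrt_unique)
  show s: "square_summable f"
    unfolding square_summable_def
    by (rule nonneg_bdd_above_summable_on) (auto intro!: bdd_aboveI2[where M = "C\<^sup>2"] bd)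
  have "(\<Sum>\<^sub>\<infinity>g. (cmod (f g))\<^sup>2) \<le> C\<^sup>2"
    using s unfolding square_summable_def
    by (intro infsum_le_finite_sums) (auto intro: bd)
  then show "l2_norm f \<le> C"
    unfolding l2_norm_def using C by (simp add: real_le_lsqrt infsum_nonneg)
qed

lemma cmod_le_l2_norm: "square_summable f \<Longrightarrow> cmod (f g) \<le> l2_norm f"
  using L2_set_le_l2_norm[of f "{g}"] by (simp add: L2_set_def)

lemma l2_norm_nonneg: "0 \<le> l2_norm f"
  unfolding l2_norm_def by (simp add: infsum_nonneg)

lemma square_summable_add:
  assumes "square_summable f" "square_summable h"
  shows "square_summable (\<lambda>g. f g + h g)" "l2_norm (\<lambda>g. f g + h g) \<le> l2_norm f + l2_norm h"
proof -
  have "L2_set (\<lambda>g. cmod (f g + h g)) F \<le> l2_norm f + l2_norm h" if "finite F" for F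
  proof -
    have "L2_set (\<lambda>g. cmod (f g + h g)) F \<le> L2_set (\<lambda>g. cmod (f g) + cmod (h g)) F"
      by (intro L2_set_mono norm_triangle_ineq) auto
    also have "\<dots> \<le> L2_set (\<lambda>g. cmod (f g)) F + L2_set (\<lambda>g. cmod (h g)) F"
      by (rule L2_set_triangle_ineq)
    also have "\<dots> \<le> l2_norm f + l2_norm h"
      by (intro add_mono L2_set_le_l2_norm assms that)
    finally show ?thesis .
  qed
  then show "square_summable (\<lambda>g. f g + h g)"
    "l2_norm (\<lambda>g. f g + h g) \<le> l2_norm f + l2_norm h"
    by (blast intro: square_summable_boundI)+
qed

lemma square_summable_scale:
  assumes "square_summable f"
  shows "square_summable (\<lambda>g. c * f g)" "l2_norm (\<lambda>g. c * f g) = cmod c * l2_norm f"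
  using assms unfolding square_summable_def l2_norm_def
  by (auto simp: norm_mult power_mult_distrib infsum_cmult_right' real_sqrt_mult
      intro: summable_on_cmult_right)

lemma square_summable_translate:
  fixes f :: "'g::group_add \<Rightarrow> complex"
  assumes "square_summable f"
  shows "square_summable (\<lambda>g. f (- h + g))" "l2_norm (\<lambda>g. f (- h + g)) = l2_norm f"
proof -
  have b: "bij_betw (\<lambda>g. - h + g) UNIV UNIV"
    by (rule bij_betwI[where g = "\<lambda>g. h + g"]) (auto simp: add.assoc[symmetric])
  show "square_summable (\<lambda>g. f (- h + g))"
    using assms summable_on_reindex_bij_betw[OF b, of "\<lambda>g. (cmod (f g))\<^sup>2"]
    unfolding square_summable_def by simp
  show "l2_norm (\<lambda>g. f (- h + g)) = l2_norm f"
    using infsum_reindex_bij_betw[OF b, of "\<lambda>g. (cmod (f g))\<^sup>2"]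
    unfolding l2_norm_def by simp
qed

lemma square_summable_zero: "square_summable (\<lambda>_. 0)"
  unfolding square_summable_def by simp

typedef 'g ell2 = "{f :: 'g \<Rightarrow> complex. square_summable f}"
  morphisms coeff_ell2 Abs_ell2
  using square_summable_zero by blast

setup_lifting type_definition_ell2

lemma square_summable_coeff [simp]: "square_summable (coeff_ell2 x)"
  using coeff_ell2 by blast

lemma ell2_eqI: "(\<And>g. coeff_ell2 x g = coeff_ell2 y g) \<Longrightarrow> x = y"
  by (simp add: coeff_ell2_inject[symmetric] fun_eq_iff)

lift_definition scaleC_ell2 :: "complex \<Rightarrow> 'g ell2 \<Rightarrow> 'g ell2" is "\<lambda>c f g. c * f g"
  by (rule square_summable_scale)

instantiation ell2 :: (type) real_normed_vector
begin

lift_definition zero_ell2 :: "'a ell2" is "\<lambda>_. 0"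
  by (rule square_summable_zero)

lift_definition plus_ell2 :: "'a ell2 \<Rightarrow> 'a ell2 \<Rightarrow> 'a ell2" is "\<lambda>f h g. f g + h g"
  by (rule square_summable_add)

lift_definition uminus_ell2 :: "'a ell2 \<Rightarrow> 'a ell2" is "\<lambda>f g. - f g"
  by (simp add: square_summable_def)

lift_definition minus_ell2 :: "'a ell2 \<Rightarrow> 'a ell2 \<Rightarrow> 'a ell2" is "\<lambda>f h g. f g - h g"
proof -
  fix f h :: "'a \<Rightarrow> complex"
  assume "square_summable f" "square_summable h"
  from square_summable_add(1)[OF this(1) square_summable_scale(1)[OF this(2), of "-1"]]
  show "square_summable (\<lambda>g. f g - h g)" by simp
qed

lift_definition scaleR_ell2 :: "real \<Rightarrow> 'a ell2 \<Rightarrow> 'a ell2" is "\<lambda>r f g. complex_of_real r * f g"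
  by (rule square_summable_scale)

lift_definition norm_ell2 :: "'a ell2 \<Rightarrow> real" is l2_norm .

definition dist_ell2 :: "'a ell2 \<Rightarrow> 'a ell2 \<Rightarrow> real" where
  "dist_ell2 x y = norm (x - y)"

definition sgn_ell2 :: "'a ell2 \<Rightarrow> 'a ell2" where
  "sgn_ell2 x = scaleR (inverse (norm x)) x"

definition uniformity_ell2 :: "('a ell2 \<times> 'a ell2) filter" where
  "uniformity_ell2 = (INF e\<in>{0<..}. principal {(x, y). dist x y < e})"

definition open_ell2 :: "'a ell2 set \<Rightarrow> bool" where
  "open_ell2 U \<longleftrightarrow> (\<forall>x\<in>U. eventually (\<lambda>(x', y). x' = x \<longrightarrow> y \<in> U) uniformity)"

instance
proof
  fix x y z :: "'a ell2" and a b :: real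
  show "x + y + z = x + (y + z)" by transfer (simp add: add.assoc)
  show "x + y = y + x" by transfer (simp add: add.commute)
  show "0 + x = x" by transfer simp
  show "- x + x = 0" by transfer simp
  show "x - y = x + - y" by transfer simp
  show "a *\<^sub>R (x + y) = a *\<^sub>R x + a *\<^sub>R y" by transfer (simp add: distrib_left)
  show "(a + b) *\<^sub>R x = a *\<^sub>R x + b *\<^sub>R x" by transfer (simp add: distrib_right)
  show "a *\<^sub>R b *\<^sub>R x = (a * b) *\<^sub>R x" by transfer (simp add: mult.assoc)
  show "1 *\<^sub>R x = x" by transfer simp
  show "dist x y = norm (x - y)" by (rule dist_ell2_def)
  show "sgn x = inverse (norm x) *\<^sub>R x" by (rule sgn_ell2_def)
  show "uniformity = (INF e\<in>{0<..}. principal {(x :: 'a ell2, y). dist x y < e})"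
    by (rule uniformity_ell2_def)
  show "open U = (\<forall>x\<in>U. eventually (\<lambda>(x', y). x' = x \<longrightarrow> y \<in> U) uniformity)"
    for U :: "'a ell2 set"
    by (rule open_ell2_def)
  show "norm x = 0 \<longleftrightarrow> x = 0"
  proof transfer
    fix f :: "'a \<Rightarrow> complex" assume f: "square_summable f"
    show "l2_norm f = 0 \<longleftrightarrow> f = (\<lambda>_. 0)"
    proof
      assume "l2_norm f = 0"
      then have "f g = 0" for g using cmod_le_l2_norm[OF f, of g] by simp
      then show "f = (\<lambda>_. 0)" by blast
    qed (simp add: l2_norm_def)
  qed
  show "norm (x + y) \<le> norm x + norm y" by transfer (rule square_summable_add)
  show "norm (a *\<^sub>R x) = \<bar>a\<bar> * norm x" by transfer (simp add: square_summable_scale)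
qed

end

lemma cmod_coeff_le_norm: "cmod (coeff_ell2 x g) \<le> norm x"
  by transfer (rule cmod_le_l2_norm)

lemma norm_scaleC_ell2: "norm (scaleC_ell2 c x) = cmod c * norm x"
  by transfer (rule square_summable_scale)

lemma bounded_linear_scaleC_ell2: "bounded_linear (scaleC_ell2 c)"
proof (rule bounded_linear_intro[where K = "cmod c"])
  fix x y :: "'a ell2" and r :: real
  show "scaleC_ell2 c (x + y) = scaleC_ell2 c x + scaleC_ell2 c y"
    by transfer (simp add: distrib_left)
  show "scaleC_ell2 c (r *\<^sub>R x) = r *\<^sub>R scaleC_ell2 c x"
    by transfer (simp add: mult_ac)
  show "norm (scaleC_ell2 c x) \<le> norm x * cmod c"
    by (simp add: norm_scaleC_ell2)
qed

instance ell2 :: (type) banach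
proof
  fix X :: "nat \<Rightarrow> 'a ell2"
  assume X: "Cauchy X"
  have "Cauchy (\<lambda>n. coeff_ell2 (X n) g)" for g
  proof (rule metric_CauchyI)
    fix e :: real assume "e > 0"
    then obtain N where N: "\<forall>m\<ge>N. \<forall>n\<ge>N. dist (X m) (X n) < e" using X unfolding Cauchy_def by blast
    have "dist (coeff_ell2 (X m) g) (coeff_ell2 (X n) g) \<le> dist (X m) (X n)" for m n
      using cmod_coeff_le_norm[of "X m - X n" g]
      by (simp add: dist_norm minus_ell2.rep_eq)
    with N show "\<exists>N. \<forall>m\<ge>N. \<forall>n\<ge>N. dist (coeff_ell2 (X m) g) (coeff_ell2 (X n) g) < e"
      by (meson order_le_less_trans)
  qed
  then obtain l where l: "\<And>g. (\<lambda>n. coeff_ell2 (X n) g) \<longlonglongrightarrow> l g"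
    by (meson Cauchy_convergent convergent_def)
  have key: "\<exists>N. \<forall>n\<ge>N. square_summable (\<lambda>g. coeff_ell2 (X n) g - l g) \<and>
      l2_norm (\<lambda>g. coeff_ell2 (X n) g - l g) \<le> e" if "e > 0" for e
  proof -
    obtain N where N: "\<And>m n. m \<ge> N \<Longrightarrow> n \<ge> N \<Longrightarrow> dist (X m) (X n) < e"
      using X \<open>e > 0\<close> unfolding Cauchy_def by blast
    have "L2_set (\<lambda>g. cmod (coeff_ell2 (X n) g - l g)) F \<le> e" if n: "n \<ge> N" and F: "finite F" for n F
    proof (rule LIMSEQ_le_const2)
      show "(\<lambda>m. L2_set (\<lambda>g. cmod (coeff_ell2 (X n) g - coeff_ell2 (X m) g)) F)
          \<longlonglongrightarrow> L2_set (\<lambda>g. cmod (coeff_ell2 (X n) g - l g)) F"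
        unfolding L2_set_def by (intro tendsto_intros l)
      have "L2_set (\<lambda>g. cmod (coeff_ell2 (X n) g - coeff_ell2 (X m) g)) F \<le> e" if "m \<ge> N" for m
      proof -
        have "L2_set (\<lambda>g. cmod (coeff_ell2 (X n - X m) g)) F \<le> norm (X n - X m)"
          using F L2_set_le_l2_norm[of "coeff_ell2 (X n - X m)" F] by (simp add: norm_ell2.rep_eq)
        also have "\<dots> \<le> e" using N[OF n that] by (simp add: dist_norm)
        finally show ?thesis by (simp add: minus_ell2.rep_eq)
      qed
      then show "\<exists>N. \<forall>m\<ge>N. L2_set (\<lambda>g. cmod (coeff_ell2 (X n) g - coeff_ell2 (X m) g)) F \<le> e"
        by blast
    qed
    then have "square_summable (\<lambda>g. coeff_ell2 (X n) g - l g)"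
        "l2_norm (\<lambda>g. coeff_ell2 (X n) g - l g) \<le> e" if "n \<ge> N" for n
      using square_summable_boundI[of "\<lambda>g. coeff_ell2 (X n) g - l g" e] that by blast+
    then show ?thesis by blast
  qed
  have "(0 :: real) < 1" by simp
  from key[OF this] obtain n where n: "square_summable (\<lambda>g. coeff_ell2 (X n) g - l g)" by blast
  have "square_summable l"
    using square_summable_add(1)[OF square_summable_coeff[of "X n"] square_summable_scale(1)[OF n, of "-1"]]
    by simp
  then have L: "coeff_ell2 (Abs_ell2 l) = l" by (simp add: Abs_ell2_inverse)
  have "X \<longlonglongrightarrow> Abs_ell2 l"
  proof (rule metric_LIMSEQ_I)
    fix e :: real assume "e > 0"
    then obtain N where N: "\<forall>n\<ge>N. l2_norm (\<lambda>g. coeff_ell2 (X n) g - l g) \<le> e / 2"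
      using key[OF half_gt_zero[OF \<open>e > 0\<close>]] by blast
    have "dist (X n) (Abs_ell2 l) < e" if "n \<ge> N" for n
      using N[rule_format, OF that] \<open>e > 0\<close> by (simp add: dist_norm norm_ell2.rep_eq minus_ell2.rep_eq L)
    then show "\<exists>N. \<forall>n\<ge>N. dist (X n) (Abs_ell2 l) < e" by blast
  qed
  then show "convergent X" by (rule convergentI)
qed

section \<open>The reduced group C*-algebra\<close>

type_synonym 'g l2_operator = "'g ell2 \<Rightarrow>\<^sub>L 'g ell2"

definition translate :: "'g::group_add \<Rightarrow> 'g ell2 \<Rightarrow> 'g ell2" where
  "translate h x = Abs_ell2 (\<lambda>g. coeff_ell2 x (- h + g))"

lemma coeff_translate: "coeff_ell2 (translate h x) g = coeff_ell2 x (- h + g)"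
  unfolding translate_def by (simp add: Abs_ell2_inverse square_summable_translate)

lemma norm_translate: "norm (translate h x) = norm x"
  by (simp add: norm_ell2.rep_eq coeff_translate[abs_def] square_summable_translate)

lemma bounded_linear_translate: "bounded_linear (translate h)"
  by (rule bounded_linear_intro[where K = 1])
    (auto intro!: ell2_eqI simp: coeff_translate plus_ell2.rep_eq scaleR_ell2.rep_eq norm_translate)

lemma coeff_sum_ell2: "coeff_ell2 (\<Sum>i\<in>I. x i) g = (\<Sum>i\<in>I. coeff_ell2 (x i) g)"
  by (induction I rule: infinite_finite_induct) (auto simp: zero_ell2.rep_eq plus_ell2.rep_eq)

definition left_mult :: "('g::group_add \<Rightarrow>\<^sub>0 complex) \<Rightarrow> 'g l2_operator" where
  "left_mult \<alpha> = Blinfun (\<lambda>x. \<Sum>h\<in>Poly_Mapping.keys \<alpha>.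
     scaleC_ell2 (Poly_Mapping.lookup \<alpha> h) (translate h x))"

lemma left_mult_apply:
  "left_mult \<alpha> x = (\<Sum>h\<in>Poly_Mapping.keys \<alpha>.
     scaleC_ell2 (Poly_Mapping.lookup \<alpha> h) (translate h x))"
  unfolding left_mult_def
  by (subst bounded_linear_Blinfun_apply)
    (auto intro!: bounded_linear_sum bounded_linear_compose[OF bounded_linear_scaleC_ell2]
      bounded_linear_translate)

lemma coeff_left_mult:
  "coeff_ell2 (left_mult \<alpha> x) g =
    (\<Sum>h\<in>Poly_Mapping.keys \<alpha>. Poly_Mapping.lookup \<alpha> h * coeff_ell2 x (- h + g))"
  by (simp add: left_mult_apply coeff_sum_ell2 scaleC_ell2.rep_eq coeff_translate)

text \<open>The norm on the type \<^typ>\<open>'g l2_operator\<close> is the operator norm on square-summable functions.\<close>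

lemma norm_left_mult:
  "norm (left_mult \<alpha>) = (SUP x\<in>{x. norm x = 1}. norm (left_mult \<alpha> x))"
proof (rule antisym)
  let ?S = "{x :: 'a ell2. norm x = 1}"
  have le: "norm (left_mult \<alpha> x) \<le> norm (left_mult \<alpha>)" if "x \<in> ?S" for x
    using norm_blinfun[of "left_mult \<alpha>" x] that by simp
  then have bdd: "bdd_above ((\<lambda>x. norm (left_mult \<alpha> x)) ` ?S)" by (rule bdd_aboveI2)
  let ?\<delta> = "Abs_ell2 (\<lambda>g. if g = (0::'a) then 1 else 0) :: 'a ell2"
  have sq: "square_summable (\<lambda>g::'a. if g = 0 then 1 else 0)"
    unfolding square_summable_def
    by (rule finite_nonzero_values_imp_summable_on) (auto intro: finite_subset[of _ "{0}"])
  have "coeff_ell2 ?\<delta> 0 = 1" by (simp add: Abs_ell2_inverse sq)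
  then have d0: "?\<delta> \<noteq> 0" by (metis zero_ell2.rep_eq zero_neq_one)
  then have "?\<delta> /\<^sub>R norm ?\<delta> \<in> ?S" by simp
  then have ne: "?S \<noteq> {}" by blast
  then show "(SUP x\<in>?S. norm (left_mult \<alpha> x)) \<le> norm (left_mult \<alpha>)"
    by (intro cSUP_least le)
  have pos: "0 \<le> (SUP x\<in>?S. norm (left_mult \<alpha> x))"
    using ne bdd by (meson ex_in_conv cSUP_upper2 norm_ge_zero)
  show "norm (left_mult \<alpha>) \<le> (SUP x\<in>?S. norm (left_mult \<alpha> x))"
  proof (rule norm_blinfun_bound[OF pos])
    fix x :: "'a ell2"
    show "norm (left_mult \<alpha> x) \<le> (SUP x\<in>?S. norm (left_mult \<alpha> x)) * norm x"
    proof (cases "x = 0")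
      case False
      then have "norm (left_mult \<alpha> (x /\<^sub>R norm x)) \<le> (SUP x\<in>?S. norm (left_mult \<alpha> x))"
        by (intro cSUP_upper bdd) simp
      then show ?thesis using False
        by (simp add: blinfun.scaleR_right divide_simps mult.commute)
    qed simp
  qed
qed

lemma left_mult_add: "left_mult (\<alpha> + \<beta>) = left_mult \<alpha> + left_mult \<beta>"
proof (rule blinfun_eqI, rule ell2_eqI)
  fix x :: "'a ell2" and g
  let ?K = "Poly_Mapping.keys \<alpha> \<union> Poly_Mapping.keys \<beta>"
  have *: "coeff_ell2 (left_mult \<gamma> x) g = (\<Sum>h\<in>?K. Poly_Mapping.lookup \<gamma> h * coeff_ell2 x (- h + g))"
    if "Poly_Mapping.keys \<gamma> \<subseteq> ?K" for \<gamma>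
    unfolding coeff_left_mult using that
    by (intro sum.mono_neutral_left) (auto simp: in_keys_iff)
  show "coeff_ell2 (left_mult (\<alpha> + \<beta>) x) g = coeff_ell2 ((left_mult \<alpha> + left_mult \<beta>) x) g"
    using Poly_Mapping.keys_add[of \<alpha> \<beta>]
    by (simp add: * blinfun.add_left plus_ell2.rep_eq lookup_add distrib_right sum.distrib)
qed

lemma left_mult_single: "left_mult (Poly_Mapping.single h c) x = scaleC_ell2 c (translate h x)"
proof (cases "c = 0")
  case True
  then show ?thesis
    by (intro ell2_eqI) (simp add: coeff_left_mult scaleC_ell2.rep_eq)
qed (simp add: left_mult_apply)

lemma poly_mapping_add_induct [case_names single sum]:
  fixes \<alpha> :: "'g \<Rightarrow>\<^sub>0 'b::ab_group_add"
  assumes single: "\<And>h c. P (Poly_Mapping.single h c)"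
    and sum: "\<And>\<beta> \<gamma>. P \<beta> \<Longrightarrow> P \<gamma> \<Longrightarrow> P (\<beta> + \<gamma>)"
  shows "P \<alpha>"
proof -
  have "P (\<Sum>h\<in>F. Poly_Mapping.single h (Poly_Mapping.lookup \<alpha> h))" if "finite F" for F
    using that
  proof (induction F rule: finite_induct)
    case empty
    show ?case using single[of undefined 0] by simp
  qed (simp add: single sum)
  moreover have "(\<Sum>h\<in>Poly_Mapping.keys \<alpha>. Poly_Mapping.single h (Poly_Mapping.lookup \<alpha> h)) = \<alpha>"
    by (rule poly_mapping_eqI)
      (simp add: lookup_sum lookup_single when_def in_keys_iff)
  ultimately show ?thesis by (metis finite_keys)
qed

lemma left_mult_mult: "left_mult (\<alpha> * \<beta>) = left_mult \<alpha> o\<^sub>L left_mult \<beta>"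
proof (induction \<alpha> rule: poly_mapping_add_induct)
  case (single h c)
  show ?case
  proof (induction \<beta> rule: poly_mapping_add_induct)
    case (single k d)
    show ?case
      by (intro blinfun_eqI ell2_eqI)
        (simp add: mult_single left_mult_single scaleC_ell2.rep_eq coeff_translate minus_add add.assoc
          diff_conv_add_uminus del: add_uminus_conv_diff)
  next
    case (sum f g)
    then show ?case
      by (simp add: distrib_left left_mult_add
          bounded_bilinear.add_right[OF bounded_bilinear_blinfun_compose])
  qed
next
  case (sum f g)
  then show ?case
    by (simp add: distrib_right left_mult_add
        bounded_bilinear.add_left[OF bounded_bilinear_blinfun_compose])
qed

text \<open>
  Since the space of bounded operators is complete, the completion of the group ring in the
  operator norm is its norm closure.
\<close>

definition cstar_red :: "'g::group_add l2_operator set" where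
  "cstar_red = closure (range left_mult)"

definition scaleC_op :: "complex \<Rightarrow> 'g l2_operator \<Rightarrow> 'g l2_operator" where
  "scaleC_op c T = Blinfun (scaleC_ell2 c) o\<^sub>L T"

definition translate_op :: "'g::group_add \<Rightarrow> 'g l2_operator \<Rightarrow> 'g l2_operator" where
  "translate_op h T = left_mult (Poly_Mapping.single h 1) o\<^sub>L T"

lemma scaleC_op_apply: "scaleC_op c T x = scaleC_ell2 c (T x)"
  by (simp add: scaleC_op_def bounded_linear_Blinfun_apply bounded_linear_scaleC_ell2)

lemma translate_op_apply: "translate_op h T x = translate h (T x)"
  by (intro ell2_eqI) (simp add: translate_op_def left_mult_single scaleC_ell2.rep_eq)

section \<open>First cohomology of a Banach space with a group action\<close>

text \<open>
  The Banach space is a closed subspace \<open>M\<close> of an ambient real Banach space, with complex scalar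
  multiplication \<open>cscale\<close> and group action \<open>act\<close>.
\<close>

locale banach_group_module =
  fixes M :: "'m::banach set" and cscale :: "complex \<Rightarrow> 'm \<Rightarrow> 'm" and act :: "'g::group_add \<Rightarrow> 'm \<Rightarrow> 'm"
  assumes closed_M: "closed M"
    and zero_M: "0 \<in> M"
    and add_M: "x \<in> M \<Longrightarrow> y \<in> M \<Longrightarrow> x + y \<in> M"
    and scale_M: "x \<in> M \<Longrightarrow> cscale c x \<in> M"
    and scale_add_right: "x \<in> M \<Longrightarrow> y \<in> M \<Longrightarrow> cscale c (x + y) = cscale c x + cscale c y"
    and scale_add_left: "x \<in> M \<Longrightarrow> cscale (c + d) x = cscale c x + cscale d x"
    and scale_scale: "x \<in> M \<Longrightarrow> cscale c (cscale d x) = cscale (c * d) x"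
    and scale_of_real: "x \<in> M \<Longrightarrow> cscale (complex_of_real r) x = r *\<^sub>R x"
    and norm_scale: "x \<in> M \<Longrightarrow> norm (cscale c x) = cmod c * norm x"
    and act_M: "x \<in> M \<Longrightarrow> act a x \<in> M"
    and act_zero: "x \<in> M \<Longrightarrow> act 0 x = x"
    and act_act: "x \<in> M \<Longrightarrow> act (a + b) x = act a (act b x)"
    and act_add: "x \<in> M \<Longrightarrow> y \<in> M \<Longrightarrow> act a (x + y) = act a x + act a y"
    and act_scale: "x \<in> M \<Longrightarrow> act a (cscale c x) = cscale c (act a x)"
    and continuous_act: "continuous_on M (act a)"

definition cocycles :: "'m::real_normed_vector set \<Rightarrow> ('g::group_add \<Rightarrow> 'm \<Rightarrow> 'm) \<Rightarrow> ('g \<Rightarrow> 'm) set"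
  where "cocycles M act = {f. (\<forall>a. f a \<in> M) \<and> (\<forall>a b. act a (f b) - f (a + b) + f a = 0)}"

definition coboundaries :: "'m::real_normed_vector set \<Rightarrow> ('g::group_add \<Rightarrow> 'm \<Rightarrow> 'm) \<Rightarrow> ('g \<Rightarrow> 'm) set"
  where "coboundaries M act = {f. \<exists>\<alpha>\<in>M. \<forall>b. f b = act b \<alpha> - \<alpha>}"

definition cohomologous ::
    "'m::real_normed_vector set \<Rightarrow> ('g::group_add \<Rightarrow> 'm \<Rightarrow> 'm) \<Rightarrow> (('g \<Rightarrow> 'm) \<times> ('g \<Rightarrow> 'm)) set"
  where "cohomologous M act =
    {(f, h). f \<in> cocycles M act \<and> h \<in> cocycles M act \<and> (\<lambda>a. f a - h a) \<in> coboundaries M act}"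

text \<open>The fields \<open>mult\<close> and \<open>one\<close> of a module record play no role.\<close>

definition H1 ::
    "'m::real_normed_vector set \<Rightarrow> (complex \<Rightarrow> 'm \<Rightarrow> 'm) \<Rightarrow> ('g::group_add \<Rightarrow> 'm \<Rightarrow> 'm) \<Rightarrow>
     (complex, ('g \<Rightarrow> 'm) set) module"
  where "H1 M cscale act =
    \<lparr>carrier = cocycles M act // cohomologous M act,
     mult = undefined,
     one = undefined,
     zero = cohomologous M act `` {\<lambda>_. 0},
     add = (\<lambda>X Y. \<Union>f\<in>X. \<Union>h\<in>Y. cohomologous M act `` {\<lambda>a. f a + h a}),
     smult = (\<lambda>c X. \<Union>f\<in>X. cohomologous M act `` {\<lambda>a. cscale c (f a)})\<rparr>"

text \<open>
  The finest topology on the image of \<open>p\<close> that makes \<open>p\<close> continuous; see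
  \<open>quotient_map_quotient_topology\<close> below.
\<close>

definition quotient_topology :: "'a topology \<Rightarrow> ('a \<Rightarrow> 'b) \<Rightarrow> 'b topology" where
  "quotient_topology X p =
    topology (\<lambda>U. U \<subseteq> p ` topspace X \<and> openin X {x \<in> topspace X. p x \<in> U})"

text \<open>Pointwise convergence in norm is the product of the norm topologies.\<close>

definition cocycle_topology ::
    "'m::real_normed_vector set \<Rightarrow> ('g::group_add \<Rightarrow> 'm \<Rightarrow> 'm) \<Rightarrow> ('g \<Rightarrow> 'm) topology"
  where "cocycle_topology M act =
    subtopology (product_topology (\<lambda>_. euclidean) UNIV) (cocycles M act)"

definition H1_topology ::
    "'m::real_normed_vector set \<Rightarrow> ('g::group_add \<Rightarrow> 'm \<Rightarrow> 'm) \<Rightarrow> ('g \<Rightarrow> 'm) set topology"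
  where "H1_topology M act =
    quotient_topology (cocycle_topology M act) (\<lambda>f. cohomologous M act `` {f})"

lemma openin_quotient_topology:
  "openin (quotient_topology X p) U \<longleftrightarrow>
    U \<subseteq> p ` topspace X \<and> openin X {x \<in> topspace X. p x \<in> U}"
proof -
  have "istopology (\<lambda>U. U \<subseteq> p ` topspace X \<and> openin X {x \<in> topspace X. p x \<in> U})"
    unfolding istopology_def
  proof (intro conjI allI impI)
    fix S T
    assume "S \<subseteq> p ` topspace X \<and> openin X {x \<in> topspace X. p x \<in> S}"
      and "T \<subseteq> p ` topspace X \<and> openin X {x \<in> topspace X. p x \<in> T}"
    moreover have "{x \<in> topspace X. p x \<in> S \<inter> T} =
        {x \<in> topspace X. p x \<in> S} \<inter> {x \<in> topspace X. p x \<in> T}" by blast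
    ultimately show "S \<inter> T \<subseteq> p ` topspace X" "openin X {x \<in> topspace X. p x \<in> S \<inter> T}"
      by auto
  next
    fix K
    assume K: "\<forall>U\<in>K. U \<subseteq> p ` topspace X \<and> openin X {x \<in> topspace X. p x \<in> U}"
    then show "\<Union>K \<subseteq> p ` topspace X" by blast
    have "{x \<in> topspace X. p x \<in> \<Union>K} = (\<Union>U\<in>K. {x \<in> topspace X. p x \<in> U})" by blast
    with K show "openin X {x \<in> topspace X. p x \<in> \<Union>K}" by auto
  qed
  then show ?thesis unfolding quotient_topology_def by (simp add: topology_inverse')
qed

lemma quotient_map_quotient_topology: "quotient_map X (quotient_topology X p) p"
proof -
  have "topspace (quotient_topology X p) = p ` topspace X"
  proof
    show "topspace (quotient_topology X p) \<subseteq> p ` topspace X"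
      using openin_topspace[of "quotient_topology X p"] unfolding openin_quotient_topology by blast
    have "openin (quotient_topology X p) (p ` topspace X)"
      unfolding openin_quotient_topology
      by (metis (no_types, lifting) Collect_cong imageI order_refl openin_topspace Collect_mem_eq)
    then show "p ` topspace X \<subseteq> topspace (quotient_topology X p)" by (rule openin_subset)
  qed
  then show ?thesis unfolding quotient_map_def openin_quotient_topology by blast
qed

lemma topspace_cocycle_topology: "topspace (cocycle_topology M act) = cocycles M act"
  by (simp add: cocycle_topology_def)

context banach_group_module
begin

lemma diff_M: "x \<in> M \<Longrightarrow> y \<in> M \<Longrightarrow> x - y \<in> M"
  using add_M[of x "(-1) *\<^sub>R y"] scale_M[of y "complex_of_real (-1)"] scale_of_real[of y "-1"] by simp

lemma scale_zero: "cscale c 0 = 0"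
  using norm_scale[OF zero_M, of c] by simp

lemma act_zero_right: "act a 0 = 0"
  using act_add[OF zero_M zero_M, of a] by simp

lemma act_diff: "x \<in> M \<Longrightarrow> y \<in> M \<Longrightarrow> act a (x - y) = act a x - act a y"
  using act_add[of "x - y" y a] diff_M by (simp add: algebra_simps)

lemma scale_diff: "x \<in> M \<Longrightarrow> y \<in> M \<Longrightarrow> cscale c (x - y) = cscale c x - cscale c y"
  using scale_add_right[of "x - y" y c] diff_M by (simp add: algebra_simps)

lemma cocycle_M: "f \<in> cocycles M act \<Longrightarrow> f a \<in> M"
  by (simp add: cocycles_def)

lemma cocycle_eq: "f \<in> cocycles M act \<longleftrightarrow> (\<forall>a. f a \<in> M) \<and> (\<forall>a b. f (a + b) = act a (f b) + f a)"
  unfolding cocycles_def by (auto simp: algebra_simps)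

lemma zero_cocycle: "(\<lambda>_. 0) \<in> cocycles M act"
  by (simp add: cocycle_eq zero_M act_zero_right)

lemma add_cocycle: "f \<in> cocycles M act \<Longrightarrow> h \<in> cocycles M act \<Longrightarrow> (\<lambda>a. f a + h a) \<in> cocycles M act"
  by (simp add: cocycle_eq add_M act_add)

lemma scale_cocycle: "f \<in> cocycles M act \<Longrightarrow> (\<lambda>a. cscale c (f a)) \<in> cocycles M act"
  by (simp add: cocycle_eq scale_M act_scale scale_add_right act_M)

lemma coboundary_cocycle: "coboundaries M act \<subseteq> cocycles M act"
  by (auto simp: coboundaries_def cocycle_eq act_diff act_act act_M diff_M)

lemma zero_coboundary: "(\<lambda>_. 0) \<in> coboundaries M act"
  unfolding coboundaries_def using zero_M act_zero_right by force

lemma add_coboundary: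
  assumes "f \<in> coboundaries M act" "h \<in> coboundaries M act"
  shows "(\<lambda>a. f a + h a) \<in> coboundaries M act"
proof -
  obtain x y where "x \<in> M" "y \<in> M" "\<forall>b. f b = act b x - x" "\<forall>b. h b = act b y - y"
    using assms unfolding coboundaries_def by blast
  then show ?thesis
    unfolding coboundaries_def by (intro CollectI bexI[of _ "x + y"]) (auto simp: act_add add_M)
qed

lemma scale_coboundary:
  assumes "f \<in> coboundaries M act"
  shows "(\<lambda>a. cscale c (f a)) \<in> coboundaries M act"
proof -
  obtain x where "x \<in> M" "\<forall>b. f b = act b x - x"
    using assms unfolding coboundaries_def by blast
  then show ?thesis
    unfolding coboundaries_def
    by (intro CollectI bexI[of _ "cscale c x"]) (auto simp: scale_diff act_scale act_M scale_M)
qed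

lemma equiv_cohomologous: "equiv (cocycles M act) (cohomologous M act)"
proof (rule equivI)
  show "cohomologous M act \<subseteq> cocycles M act \<times> cocycles M act"
    by (auto simp: cohomologous_def)
  show "refl_on (cocycles M act) (cohomologous M act)"
    by (auto simp: refl_on_def cohomologous_def zero_coboundary)
  show "sym (cohomologous M act)"
  proof (rule symI)
    fix f h assume fh: "(f, h) \<in> cohomologous M act"
    then have "(\<lambda>a. f a - h a) \<in> coboundaries M act" by (simp add: cohomologous_def)
    then have "(\<lambda>a. cscale (complex_of_real (-1)) (f a - h a)) \<in> coboundaries M act"
      by (rule scale_coboundary)
    moreover have "cscale (complex_of_real (-1)) (f a - h a) = h a - f a" for a
      using fh by (subst scale_of_real) (auto simp: cohomologous_def cocycle_M diff_M)
    ultimately show "(h, f) \<in> cohomologous M act" using fh by (simp add: cohomologous_def)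
  qed
  show "trans (cohomologous M act)"
  proof (rule transI)
    fix f h k assume *: "(f, h) \<in> cohomologous M act" "(h, k) \<in> cohomologous M act"
    then have "(\<lambda>a. (f a - h a) + (h a - k a)) \<in> coboundaries M act"
      by (intro add_coboundary) (auto simp: cohomologous_def)
    with * show "(f, k) \<in> cohomologous M act" by (simp add: cohomologous_def)
  qed
qed

lemma H1_add:
  assumes "f \<in> cocycles M act" "h \<in> cocycles M act"
  shows "add (H1 M cscale act) (cohomologous M act `` {f}) (cohomologous M act `` {h}) =
    cohomologous M act `` {\<lambda>a. f a + h a}"
proof -
  have "congruent2 (cohomologous M act) (cohomologous M act)
      (\<lambda>f h. cohomologous M act `` {\<lambda>a. f a + h a})"
  proof (rule congruent2I')
    fix f f' h h'
    assume *: "(f, f') \<in> cohomologous M act" "(h, h') \<in> cohomologous M act"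
    then have "(\<lambda>a. (f a - f' a) + (h a - h' a)) \<in> coboundaries M act"
      by (intro add_coboundary) (auto simp: cohomologous_def)
    with * have "((\<lambda>a. f a + h a), (\<lambda>a. f' a + h' a)) \<in> cohomologous M act"
      by (simp add: cohomologous_def add_cocycle algebra_simps)
    then show "cohomologous M act `` {\<lambda>a. f a + h a} = cohomologous M act `` {\<lambda>a. f' a + h' a}"
      by (rule equiv_class_eq[OF equiv_cohomologous])
  qed
  from UN_equiv_class2[OF equiv_cohomologous equiv_cohomologous this assms]
  show ?thesis by (simp add: H1_def)
qed

lemma H1_smult:
  assumes "f \<in> cocycles M act"
  shows "smult (H1 M cscale act) c (cohomologous M act `` {f}) =
    cohomologous M act `` {\<lambda>a. cscale c (f a)}"
proof -
  have "congruent (cohomologous M act) (\<lambda>f. cohomologous M act `` {\<lambda>a. cscale c (f a)})"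
  proof (rule congruentI)
    fix f f' assume *: "(f, f') \<in> cohomologous M act"
    then have "(\<lambda>a. cscale c (f a - f' a)) \<in> coboundaries M act"
      by (intro scale_coboundary) (auto simp: cohomologous_def)
    with * have "((\<lambda>a. cscale c (f a)), (\<lambda>a. cscale c (f' a))) \<in> cohomologous M act"
      by (simp add: cohomologous_def scale_cocycle scale_diff cocycle_M)
    then show "cohomologous M act `` {\<lambda>a. cscale c (f a)} = cohomologous M act `` {\<lambda>a. cscale c (f' a)}"
      by (rule equiv_class_eq[OF equiv_cohomologous])
  qed
  from UN_equiv_class[OF equiv_cohomologous this assms] show ?thesis by (simp add: H1_def)
qed

lemma H1_carrier: "carrier (H1 M cscale act) = (\<lambda>f. cohomologous M act `` {f}) ` cocycles M act"
  by (auto simp: H1_def quotient_def)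

lemma H1_zero: "zero (H1 M cscale act) = cohomologous M act `` {\<lambda>_. 0}"
  by (simp add: H1_def)

lemma abelian_group_H1: "abelian_group (H1 M cscale act)"
proof (rule abelian_groupI; (unfold H1_carrier)?; (elim imageE)?; hypsubst?)
  fix f assume f: "f \<in> cocycles M act"
  let ?m = "\<lambda>a. cscale (complex_of_real (-1)) (f a)"
  have "add (H1 M cscale act) (cohomologous M act `` {?m}) (cohomologous M act `` {f}) =
      zero (H1 M cscale act)"
    using f scale_cocycle[OF f, of "complex_of_real (-1)"]
    by (subst H1_add) (simp_all only: H1_zero scale_of_real cocycle_M scaleR_minus1_left left_minus)
  with f show "\<exists>y\<in>(\<lambda>f. cohomologous M act `` {f}) ` cocycles M act.
      add (H1 M cscale act) y (cohomologous M act `` {f}) = zero (H1 M cscale act)"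
    using scale_cocycle by blast
qed (auto simp: H1_add H1_zero add_cocycle zero_cocycle add_ac)

lemma vectorspace_H1: "vectorspace class_ring (H1 M cscale act)"
proof -
  have "Module.module class_ring (H1 M cscale act)"
  proof (rule moduleI; (unfold H1_carrier)?; (elim imageE)?; hypsubst?)
    show "cring (class_ring :: complex ring)" by (rule fieldE(1)[OF class_field])
  qed (auto simp: abelian_group_H1 H1_add H1_smult scale_cocycle add_cocycle cocycle_M
      scale_add_left scale_add_right scale_scale scale_of_real[of _ 1, simplified])
  then show ?thesis by (simp add: vectorspace_def class_field)
qed

lemma topspace_H1_topology: "topspace (H1_topology M act) = carrier (H1 M cscale act)"
  using quotient_imp_surjective_map[OF quotient_map_quotient_topology]
  unfolding H1_topology_def H1_carrier by (metis topspace_cocycle_topology)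

end

lemma banach_group_module_cstar_red: "banach_group_module cstar_red scaleC_op translate_op"
proof -
  have sc_left: "scaleC_op c (left_mult \<alpha>) = left_mult (Poly_Mapping.single 0 c * \<alpha>)"
    for c and \<alpha> :: "'a \<Rightarrow>\<^sub>0 complex"
    unfolding left_mult_mult
    by (intro blinfun_eqI ell2_eqI)
      (simp add: scaleC_op_apply left_mult_single scaleC_ell2.rep_eq coeff_translate)
  have tr_left: "translate_op h (left_mult \<alpha>) = left_mult (Poly_Mapping.single h 1 * \<alpha>)"
    for h and \<alpha> :: "'a \<Rightarrow>\<^sub>0 complex"
    unfolding left_mult_mult translate_op_def ..
  have cont_tr: "continuous_on S (translate_op h)" for h :: 'a and S
    unfolding translate_op_def[abs_def] by (intro continuous_intros)
  have cont_sc: "continuous_on S (scaleC_op c)" for c and S :: "'a l2_operator set"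
    unfolding scaleC_op_def[abs_def] by (intro continuous_intros)
  have img: "f x \<in> cstar_red" if "x \<in> cstar_red" "continuous_on UNIV f" "\<And>\<alpha>. f (left_mult \<alpha>) \<in> range left_mult"
    for f :: "'a l2_operator \<Rightarrow> 'a l2_operator" and x
  proof -
    have "f ` closure (range left_mult) \<subseteq> closure (range left_mult)"
      by (rule image_closure_subset)
        (use that closure_subset in \<open>auto intro: continuous_on_subset\<close>)
    with that show ?thesis unfolding cstar_red_def by blast
  qed
  have add: "x + y \<in> cstar_red" if xy: "x \<in> cstar_red" "y \<in> cstar_red" for x y :: "'a l2_operator"
  proof -
    have seq: "(z \<in> cstar_red) = (\<exists>u. (\<forall>n. u n \<in> range left_mult) \<and> u \<longlonglongrightarrow> z)"
      for z :: "'a l2_operator"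
      unfolding cstar_red_def by (rule closure_sequential)
    obtain u v where u: "\<forall>n. u n \<in> range left_mult" "u \<longlonglongrightarrow> x"
      and v: "\<forall>n. v n \<in> range left_mult" "v \<longlonglongrightarrow> y"
      using xy unfolding seq by blast
    have "u n + v n \<in> range left_mult" for n
    proof -
      obtain \<alpha> \<beta> where "u n = left_mult \<alpha>" "v n = left_mult \<beta>"
        using spec[OF u(1), of n] spec[OF v(1), of n] by (elim rangeE)
      then show ?thesis by (simp add: left_mult_add[symmetric])
    qed
    moreover have "(\<lambda>n. u n + v n) \<longlonglongrightarrow> x + y" by (intro tendsto_add u v)
    ultimately show ?thesis unfolding seq
      by (intro exI[of _ "\<lambda>n. u n + v n"] conjI allI)
  qed
  have zero: "0 \<in> (cstar_red :: 'a l2_operator set)"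
  proof -
    have "left_mult (0 :: 'a \<Rightarrow>\<^sub>0 complex) = 0"
      using left_mult_add[of 0 "0 :: 'a \<Rightarrow>\<^sub>0 complex"] by simp
    then show ?thesis unfolding cstar_red_def using closure_subset by (metis rangeI subsetD)
  qed
  show ?thesis
  proof
    fix x :: "'a l2_operator" and c
    show "norm (scaleC_op c x) = cmod c * norm x"
    proof (cases "c = 0")
      case True
      then have "scaleC_op c x = 0"
        by (intro blinfun_eqI ell2_eqI)
          (simp add: scaleC_op_apply scaleC_ell2.rep_eq zero_ell2.rep_eq)
      with True show ?thesis by simp
    next
      case False
      have le: "norm (scaleC_op d z) \<le> cmod d * norm z" for d and z :: "'a l2_operator"
        by (rule norm_blinfun_bound)
          (auto simp: scaleC_op_apply norm_scaleC_ell2 mult.assoc intro!: mult_left_mono norm_blinfun)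
      have "x = scaleC_op (inverse c) (scaleC_op c x)" using False
        by (intro blinfun_eqI ell2_eqI) (simp add: scaleC_op_apply scaleC_ell2.rep_eq)
      then have "norm x \<le> inverse (cmod c) * norm (scaleC_op c x)"
        using le[of "inverse c" "scaleC_op c x"] by (simp add: norm_inverse)
      then have "cmod c * norm x \<le> norm (scaleC_op c x)" using False by (simp add: field_simps)
      with le[of c x] show ?thesis by simp
    qed
  next
    fix x y :: "'a l2_operator" and c d :: complex and a b :: 'a and r :: real
    assume x: "x \<in> cstar_red"
    show "scaleC_op c x \<in> cstar_red" by (rule img[OF x cont_sc]) (simp add: sc_left)
    show "translate_op a x \<in> cstar_red" by (rule img[OF x cont_tr]) (simp add: tr_left)
    show "scaleC_op (c + d) x = scaleC_op c x + scaleC_op d x"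
      by (intro blinfun_eqI ell2_eqI)
        (simp add: scaleC_op_apply blinfun.add_left plus_ell2.rep_eq scaleC_ell2.rep_eq distrib_right)
    show "scaleC_op c (scaleC_op d x) = scaleC_op (c * d) x"
      by (intro blinfun_eqI ell2_eqI) (simp add: scaleC_op_apply scaleC_ell2.rep_eq)
    show "scaleC_op (complex_of_real r) x = r *\<^sub>R x"
      by (intro blinfun_eqI ell2_eqI)
        (simp add: scaleC_op_apply blinfun.scaleR_left scaleC_ell2.rep_eq scaleR_ell2.rep_eq)
    show "translate_op 0 x = x"
      by (intro blinfun_eqI ell2_eqI) (simp add: translate_op_apply coeff_translate)
    show "translate_op (a + b) x = translate_op a (translate_op b x)"
      by (intro blinfun_eqI ell2_eqI)
        (simp add: translate_op_apply coeff_translate minus_add add.assoc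
          diff_conv_add_uminus del: add_uminus_conv_diff)
    show "translate_op a (scaleC_op c x) = scaleC_op c (translate_op a x)"
      by (intro blinfun_eqI ell2_eqI)
        (simp add: translate_op_apply scaleC_op_apply coeff_translate scaleC_ell2.rep_eq)
    assume y: "y \<in> cstar_red"
    show "x + y \<in> cstar_red" by (rule add[OF x y])
    show "scaleC_op c (x + y) = scaleC_op c x + scaleC_op c y"
      by (intro blinfun_eqI ell2_eqI)
        (simp add: scaleC_op_apply blinfun.add_left plus_ell2.rep_eq scaleC_ell2.rep_eq distrib_left)
    show "translate_op a (x + y) = translate_op a x + translate_op a y"
      by (intro blinfun_eqI ell2_eqI)
        (simp add: translate_op_apply blinfun.add_left plus_ell2.rep_eq coeff_translate)
  next
    show "closed (cstar_red :: 'a l2_operator set)" by (simp add: cstar_red_def)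
    show "0 \<in> (cstar_red :: 'a l2_operator set)" by (rule zero)
    show "continuous_on cstar_red (translate_op a)" for a :: 'a by (rule cont_tr)
  qed
qed

end

theory Submission
  imports Defs "HOL-Real_Asymp.Real_Asymp"
begin

text \<open>
  The argument uses only that the group has a Foelner sequence \<open>F\<close> whose boundaries are
  exponentially small: \<open>card (F k - g F k) \<le> C\<^sub>g 2\<^sup>-\<^sup>k card (F k)\<close> for every \<open>g\<close>, with
  \<open>card (F k) \<ge> 4\<^sup>k\<close>.  In \<open>\<int>\<^sup>n\<close> the boxes of side length \<open>4\<^sup>k\<close> form such a sequence.

  Let \<open>E k\<close> be the operator of left multiplication by the uniform probability on \<open>F k\<close>.  Then
  \<open>g E k - E k\<close> has operator norm at most \<open>2 C\<^sub>g 2\<^sup>-\<^sup>k\<close>.  Hence, for coefficients \<open>c\<close> with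
  \<open>\<Sum>\<^sub>k |c k| 2\<^sup>-\<^sup>k < \<infinity>\<close>, the series \<open>f\<^sub>c g = \<Sum>\<^sub>k c k (g E k - E k)\<close> converges in norm.  It is a
  cocycle and a pointwise limit of the coboundaries of the partial sums
  \<open>\<Sum>\<^sub>k\<^sub><\<^sub>K c k E k\<close>, although the series \<open>\<Sum>\<^sub>k c k E k\<close> itself need not converge in norm.

  Suppose that \<open>f\<^sub>c\<close> is the coboundary of an operator \<open>T\<close>, and let \<open>u\<close> be the indicator function of
  a finite set.  Since \<open>\<parallel>E k u\<parallel>\<close> is \<open>O(2\<^sup>-\<^sup>k)\<close>, the series \<open>\<Sum>\<^sub>k c k E k u\<close> converges in the Hilbert
  space; its sum differs from \<open>T u\<close> by a translation invariant vector, and such a vector vanishes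
  because the group is infinite.  Testing with \<open>u\<close> the indicator of \<open>F N\<close> gives
  \<open>|\<Sum>\<^sub>k c k t\<^sub>k\<^sub>,\<^sub>N| \<le> \<parallel>T\<parallel>\<close>, where \<open>t\<^sub>k\<^sub>,\<^sub>N\<close> is the average over \<open>h \<in> F k\<close> of
  \<open>card (F N \<inter> h F N) / card (F N)\<close>.  These numbers are nonnegative and tend to \<open>1\<close> as \<open>N\<close> grows, so
  the partial sums of \<open>Re c\<close> would be bounded if \<open>Re c\<close> is eventually at least \<open>1\<close>.  Therefore
  \<open>f\<^sub>c\<close> is not a coboundary for such \<open>c\<close> (\<open>avg_cocycle_not_coboundary\<close>).

  With \<open>c = 1\<close> this is a limit of coboundaries that is not a coboundary, so the quotient is not
  Hausdorff.  With \<open>c k = p k\<close> for a complex polynomial \<open>p\<close>, which can be made monic when it is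
  nonzero, it shows that the linear map from polynomials to cohomology classes is injective, so the
  cohomology is infinite-dimensional.
\<close>

section \<open>Criteria for infinite dimension and for failure of the Hausdorff property\<close>

lemma not_fin_dim_if_poly_embeds:
  fixes V :: "('k::field, 'v) module" and \<Phi> :: "'k poly \<Rightarrow> 'v"
  assumes V: "vectorspace class_ring V"
    and carrier: "\<And>p. \<Phi> p \<in> carrier V"
    and add: "\<And>p q. \<Phi> (p + q) = \<Phi> p \<oplus>\<^bsub>V\<^esub> \<Phi> q"
    and scale: "\<And>c p. \<Phi> (Polynomial.smult c p) = c \<odot>\<^bsub>V\<^esub> \<Phi> p"
    and inj: "\<And>p. \<Phi> p = \<zero>\<^bsub>V\<^esub> \<Longrightarrow> p = 0"
  shows "\<not> vectorspace.fin_dim class_ring V"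
proof
  interpret vectorspace class_ring V by (rule V)
  assume fin: "fin_dim"
  let ?x = "\<lambda>j. Polynomial.monom (1::'k) j"
  let ?v = "\<lambda>j. \<Phi> (?x j)"
  have zero: "\<Phi> 0 = \<zero>\<^bsub>V\<^esub>"
    using add[of 0 0] carrier[of 0] by (metis add_0 M.add.l_cancel_one)
  have "\<Phi> p = \<Phi> q \<Longrightarrow> p = q" for p q
  proof -
    assume eq: "\<Phi> p = \<Phi> q"
    have "\<Phi> p = \<Phi> (p - q) \<oplus>\<^bsub>V\<^esub> \<Phi> q" by (simp flip: add)
    then have "\<Phi> (p - q) = \<zero>\<^bsub>V\<^esub>"
      using eq carrier by (metis M.add.r_cancel_one)
    then show "p = q" using inj by fastforce
  qed
  then have "i = j" if "?v i = ?v j" for i j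
    using that monom_eq_iff'[of "1::'k" i 1 j] by simp
  then have inj_v: "inj ?v" by (rule injI)
  have comb: "finsum V (\<lambda>w. a w \<odot>\<^bsub>V\<^esub> w) (?v ` J) = \<Phi> (\<Sum>j\<in>J. Polynomial.smult (a (?v j)) (?x j))"
    if "finite J" for a J
    using that
  proof (induction J rule: finite_induct)
    case (insert i J)
    have "?v i \<notin> ?v ` J" using insert(2) inj_v by (auto dest: injD)
    moreover have "(\<lambda>w. a w \<odot>\<^bsub>V\<^esub> w) \<in> ?v ` J \<rightarrow> carrier V"
      using carrier by (auto simp flip: scale)
    moreover have "a (?v i) \<odot>\<^bsub>V\<^esub> ?v i \<in> carrier V"
      using carrier by (simp flip: scale)
    ultimately show ?case using insert
      by (simp add: add scale)
  qed (simp add: zero)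
  define A where "A = ?v ` {..dim}"
  have A: "finite A" "A \<subseteq> carrier V" "card A = Suc dim"
    unfolding A_def using carrier inj_v by (auto simp: card_image inj_on_subset)
  have "lin_indpt A"
  proof (rule finite_lin_indpt2[OF A(1,2)])
    fix a assume "lincomb a A = \<zero>\<^bsub>V\<^esub>"
    then have "(\<Sum>j\<le>dim. Polynomial.smult (a (?v j)) (?x j)) = 0"
      unfolding lincomb_def A_def by (intro inj) (simp add: comb)
    then have coeff_0: "Polynomial.coeff (\<Sum>j\<le>dim. Polynomial.smult (a (?v j)) (?x j)) i = 0" for i
      by simp
    then have "a (?v i) = 0" if "i \<le> dim" for i
      using that coeff_0[of i] by (simp add: coeff_sum if_distrib[of "(*) _"] cong: if_cong)
    then show "\<forall>w\<in>A. a w = \<zero>\<^bsub>class_ring\<^esub>"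
      by (auto simp: A_def)
  qed
  from li_le_dim(2)[OF fin A(2) this] A(3) show False by simp
qed

context banach_group_module
begin

lemma cohomologous_zero_iff:
  assumes "f \<in> cocycles M act"
  shows "cohomologous M act `` {f} = cohomologous M act `` {\<lambda>_. 0} \<longleftrightarrow> f \<in> coboundaries M act"
  using eq_equiv_class_iff[OF equiv_cohomologous assms zero_cocycle] assms zero_cocycle
  by (simp add: cohomologous_def)

lemma sum_M: "(\<And>i. i \<in> I \<Longrightarrow> x i \<in> M) \<Longrightarrow> (\<Sum>i\<in>I. x i) \<in> M"
  by (induction I rule: infinite_finite_induct) (auto simp: zero_M add_M)

lemma coboundaryI: "x \<in> M \<Longrightarrow> (\<lambda>b. act b x - x) \<in> coboundaries M act"
  unfolding coboundaries_def by blast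

lemma cocycle_limit:
  assumes f: "\<And>k. f k \<in> cocycles M act" and lim: "\<And>a. (\<lambda>k. f k a) \<longlonglongrightarrow> h a"
  shows "h \<in> cocycles M act"
  unfolding cocycle_eq
proof (intro conjI allI)
  show M: "h a \<in> M" for a
    using closed_sequentially[OF closed_M _ lim] f cocycle_M by blast
  fix a b
  have "(\<lambda>k. act a (f k b)) \<longlonglongrightarrow> act a (h b)"
    using continuous_on_tendsto_compose[OF continuous_act lim M] f cocycle_M by simp
  then have "(\<lambda>k. act a (f k b) + f k a) \<longlonglongrightarrow> act a (h b) + h a"
    by (intro tendsto_add lim)
  moreover have "(\<lambda>k. act a (f k b) + f k a) = (\<lambda>k. f k (a + b))"
    using f by (simp add: cocycle_eq)
  ultimately show "h (a + b) = act a (h b) + h a"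
    using LIMSEQ_unique[OF lim] by metis
qed

text \<open>
  The constant sequence of the zero class converges both to the zero class and to the class of \<open>h\<close>.
\<close>

lemma not_Hausdorff_H1:
  assumes f: "\<And>k. f k \<in> coboundaries M act" and lim: "\<And>a. (\<lambda>k. f k a) \<longlonglongrightarrow> h a"
    and h: "h \<notin> coboundaries M act"
  shows "\<not> Hausdorff_space (H1_topology M act)"
proof
  let ?p = "\<lambda>f. cohomologous M act `` {f}"
  have fc: "f k \<in> cocycles M act" for k using f coboundary_cocycle by blast
  have hc: "h \<in> cocycles M act" by (rule cocycle_limit[OF fc lim])
  assume "Hausdorff_space (H1_topology M act)"
  moreover have "limitin (H1_topology M act) (?p \<circ> f) (?p h) sequentially"
  proof (rule continuous_map_limit)
    show "continuous_map (cocycle_topology M act) (H1_topology M act) ?p"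
      unfolding H1_topology_def
      by (rule quotient_imp_continuous_map[OF quotient_map_quotient_topology])
    show "limitin (cocycle_topology M act) f h sequentially"
      unfolding cocycle_topology_def
      by (simp add: limitin_subtopology limitin_componentwise fc hc lim)
  qed
  moreover have "?p \<circ> f = (\<lambda>_. ?p (\<lambda>_. 0))"
    using cohomologous_zero_iff[OF fc] f by (simp add: fun_eq_iff)
  moreover have "?p (\<lambda>_. 0) \<in> topspace (H1_topology M act)"
    unfolding topspace_H1_topology H1_carrier using zero_cocycle by blast
  ultimately have "?p h = ?p (\<lambda>_. 0)"
    using limitin_Hausdorff_unique[of "H1_topology M act" "?p \<circ> f" "?p h" sequentially "?p (\<lambda>_. 0)"]
    by simp
  with h cohomologous_zero_iff[OF hc] show False by blast
qed

end

section \<open>Averaging operators\<close>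

text \<open>The left regular representation, as bounded operators.\<close>

abbreviation left_reg :: "'g::group_add \<Rightarrow> 'g l2_operator" where
  "left_reg h \<equiv> left_mult (Poly_Mapping.single h 1)"

lemma left_reg_apply: "left_reg h x = translate h x"
  by (intro ell2_eqI) (simp add: left_mult_single scaleC_ell2.rep_eq)

lemma norm_left_reg_le: "norm (left_reg h) \<le> 1"
  by (rule norm_blinfun_bound) (simp_all add: left_reg_apply norm_translate)

lemma translate_op_left_reg: "translate_op g (left_reg h) = left_reg (g + h)"
  by (simp add: translate_op_def mult_single flip: left_mult_mult)

lemma bounded_linear_translate_op: "bounded_linear (translate_op g)"
  unfolding translate_op_def[abs_def]
  by (rule bounded_bilinear.bounded_linear_right[OF bounded_bilinear_blinfun_compose])

lemma bounded_linear_scaleC_op: "bounded_linear (scaleC_op c)"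
  unfolding scaleC_op_def[abs_def]
  by (rule bounded_bilinear.bounded_linear_right[OF bounded_bilinear_blinfun_compose])

text \<open>
  Left multiplication by the uniform probability on a finite set \<open>F\<close>; it is \<open>0\<close> if \<open>F\<close> is empty or
  infinite.
\<close>

definition averaging :: "'g::group_add set \<Rightarrow> 'g l2_operator" where
  "averaging F = (\<Sum>h\<in>F. left_reg h) /\<^sub>R real (card F)"

lemma coeff_averaging:
  "coeff_ell2 (averaging F x) g = (\<Sum>h\<in>F. coeff_ell2 x (- h + g)) / of_nat (card F)"
  by (simp add: averaging_def blinfun.scaleR_left blinfun.sum_left scaleR_ell2.rep_eq
      coeff_sum_ell2 left_reg_apply coeff_translate divide_inverse mult.commute)

lemma averaging_cstar_red: "averaging F \<in> cstar_red"
proof -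
  interpret banach_group_module "cstar_red :: 'a l2_operator set" scaleC_op translate_op
    by (rule banach_group_module_cstar_red)
  have "(\<Sum>h\<in>F. left_reg h) \<in> cstar_red"
    by (intro sum_M) (simp add: cstar_red_def subsetD[OF closure_subset])
  then show ?thesis
    unfolding averaging_def by (metis scale_M scale_of_real)
qed

text \<open>
  The terms over \<open>F \<inter> g F\<close> cancel, and the two remaining sets \<open>g F - F\<close> and \<open>F - g F\<close> have the same
  number of elements.
\<close>

lemma norm_translate_averaging_le:
  fixes F :: "'g::group_add set"
  assumes F: "finite F"
  shows "norm (translate_op g (averaging F) - averaging F) \<le> 2 * real (card (F - (+) g ` F)) / real (card F)"
proof -
  let ?G = "(+) g ` F"
  have card: "card ?G = card F" by (simp add: card_image)
  have G: "finite ?G" using F by simp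
  have "card (?G - F) = card (F - ?G)"
    using card F G by (simp add: card_Diff_subset_Int Int_commute)
  have split: "sum left_reg A = sum left_reg (A - B) + sum left_reg (A \<inter> B)" if "finite A"
    for A B :: "'g set"
    using that by (subst sum.union_disjoint[symmetric]) (auto intro: arg_cong[where f = "sum left_reg"])
  have "translate_op g (\<Sum>h\<in>F. left_reg h) = sum left_reg ?G"
    by (simp add: linear_sum[OF bounded_linear.linear[OF bounded_linear_translate_op]]
        translate_op_left_reg sum.reindex)
  then have "translate_op g (averaging F) - averaging F
      = (sum left_reg ?G - sum left_reg F) /\<^sub>R card F"
    by (simp add: averaging_def scaleR_diff_right
        linear_cmul[OF bounded_linear.linear[OF bounded_linear_translate_op]])
  also have "sum left_reg ?G - sum left_reg F = sum left_reg (?G - F) - sum left_reg (F - ?G)"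
    using split[OF G, of F] split[OF F, of ?G] by (simp add: Int_commute)
  also have "norm (\<dots> /\<^sub>R card F) \<le> (card (?G - F) + card (F - ?G)) / card F"
  proof -
    have "norm (sum left_reg A) \<le> card A" for A :: "'g set"
      using sum_norm_le[of A left_reg "\<lambda>_. 1"] norm_left_reg_le by fastforce
    then have "norm (sum left_reg (?G - F) - sum left_reg (F - ?G)) \<le> card (?G - F) + card (F - ?G)"
      by (smt (verit) norm_triangle_ineq4 of_nat_add)
    then show ?thesis by (simp add: divide_inverse mult.commute mult_left_mono)
  qed
  also have "card (?G - F) = card (F - ?G)" by fact
  finally show ?thesis by simp
qed

section \<open>Indicator functions and translation invariant vectors\<close>

text \<open>
  The indicator function of a finite set as a vector of the Hilbert space.  For infinite sets the
  indicator is not square-summable and the value is unspecified.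
\<close>

definition ind_ell2 :: "'g set \<Rightarrow> 'g ell2" where
  "ind_ell2 B = Abs_ell2 (\<lambda>g. of_bool (g \<in> B))"

lemma coeff_ind_ell2: "finite B \<Longrightarrow> coeff_ell2 (ind_ell2 B) g = of_bool (g \<in> B)"
proof -
  assume "finite B"
  then have "square_summable (\<lambda>g. of_bool (g \<in> B) :: complex)"
    unfolding square_summable_def
    by (intro finite_nonzero_values_imp_summable_on) (auto elim: finite_subset[rotated])
  then show ?thesis by (simp add: ind_ell2_def Abs_ell2_inverse)
qed

lemma norm_ind_ell2:
  assumes "finite B"
  shows "norm (ind_ell2 B) = sqrt (real (card B))"
proof -
  have "(\<Sum>\<^sub>\<infinity>g. (cmod (coeff_ell2 (ind_ell2 B) g))\<^sup>2) = (\<Sum>\<^sub>\<infinity>g\<in>B. 1)"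
    using assms by (intro infsum_cong_neutral) (auto simp: coeff_ind_ell2)
  then show ?thesis using assms by (simp add: norm_ell2.rep_eq l2_norm_def)
qed

lemma averaging_point:
  fixes F :: "'g::group_add set"
  assumes "finite F"
  shows "averaging F (ind_ell2 {y}) = ind_ell2 ((\<lambda>h. h + y) ` F) /\<^sub>R card F"
proof (rule ell2_eqI)
  fix g
  have "(- h + g = y) = (h = g - y)" for h
    by (auto simp: algebra_simps minus_add)
  then have "(\<Sum>h\<in>F. coeff_ell2 (ind_ell2 {y}) (- h + g)) = of_bool (g - y \<in> F)"
    using assms by (simp add: coeff_ind_ell2 of_bool_def sum.delta)
  moreover have "(g - y \<in> F) = (g \<in> (\<lambda>h. h + y) ` F)"
    by (force simp: image_iff)
  ultimately show "coeff_ell2 (averaging F (ind_ell2 {y})) g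
      = coeff_ell2 (ind_ell2 ((\<lambda>h. h + y) ` F) /\<^sub>R card F) g"
    using assms by (simp add: coeff_averaging scaleR_ell2.rep_eq coeff_ind_ell2 divide_inverse)
qed

text \<open>
  Averaging a point mass over \<open>F\<close> spreads it evenly over \<open>card F\<close> points, which divides its norm by
  \<open>sqrt (card F)\<close>.
\<close>

lemma norm_averaging_ind_le:
  fixes F :: "'g::group_add set"
  assumes F: "finite F" and B: "finite B"
  shows "norm (averaging F (ind_ell2 B)) \<le> real (card B) / sqrt (real (card F))"
proof -
  have "ind_ell2 B = (\<Sum>y\<in>B. ind_ell2 {y})"
    using B by (intro ell2_eqI) (simp add: coeff_sum_ell2 coeff_ind_ell2 of_bool_def sum.delta')
  then have "norm (averaging F (ind_ell2 B)) \<le> (\<Sum>y\<in>B. norm (averaging F (ind_ell2 {y})))"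
    by (simp add: blinfun.sum_right norm_sum)
  also have "\<dots> = (\<Sum>y\<in>B. 1 / sqrt (real (card F)))"
    using F real_div_sqrt[of "real (card F)"]
    by (intro sum.cong) (simp_all add: averaging_point norm_ind_ell2 card_image inj_on_def divide_simps)
  finally show ?thesis by simp
qed

text \<open>The Cauchy--Schwarz inequality against the indicator function of \<open>B\<close>.\<close>

lemma sum_coeff_le:
  assumes "finite B"
  shows "cmod (\<Sum>z\<in>B. coeff_ell2 x z) \<le> sqrt (real (card B)) * norm x"
proof -
  have "cmod (\<Sum>z\<in>B. coeff_ell2 x z) \<le> (\<Sum>z\<in>B. \<bar>1\<bar> * \<bar>cmod (coeff_ell2 x z)\<bar>)"
    by (simp add: norm_sum)
  also have "\<dots> \<le> L2_set (\<lambda>_. 1) B * L2_set (\<lambda>z. cmod (coeff_ell2 x z)) B"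
    by (rule L2_set_mult_ineq)
  also have "\<dots> \<le> sqrt (real (card B)) * norm x"
    using L2_set_le_l2_norm[of "coeff_ell2 x" B] assms
    by (intro mult_mono) (auto simp: L2_set_def norm_ell2.rep_eq sum_nonneg)
  finally show ?thesis .
qed

lemma bounded_linear_coeff: "bounded_linear (\<lambda>x. coeff_ell2 x g)"
  by (rule bounded_linear_intro[where K = 1])
    (auto simp: plus_ell2.rep_eq scaleR_ell2.rep_eq cmod_coeff_le_norm scaleR_conv_of_real)

lemma translation_invariant_ell2_eq_0:
  fixes x :: "'g::group_add ell2"
  assumes inf: "infinite (UNIV :: 'g set)" and inv: "\<And>g. translate g x = x"
  shows "x = 0"
proof (rule ell2_eqI)
  fix g
  define c where "c = coeff_ell2 x 0"
  have const: "coeff_ell2 x h = c" for h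
    unfolding c_def using inv[of h] coeff_translate[of h x h] by simp
  have "card F * (cmod c)\<^sup>2 \<le> (norm x)\<^sup>2" if "finite F" for F :: "'g set"
    using L2_set_le_l2_norm[OF square_summable_coeff[of x] that]
    by (intro sqrt_le_D) (simp add: L2_set_def const norm_ell2.rep_eq)
  then have bound: "real n * (cmod c)\<^sup>2 \<le> (norm x)\<^sup>2" for n
    using infinite_arbitrarily_large[OF inf, of n] by blast
  have "\<not> 0 < (cmod c)\<^sup>2"
  proof
    assume "0 < (cmod c)\<^sup>2"
    then obtain n where "(norm x)\<^sup>2 < real n * (cmod c)\<^sup>2"
      using reals_Archimedean3 by blast
    with bound[of n] show False by simp
  qed
  then show "coeff_ell2 x g = coeff_ell2 0 g" by (simp add: const zero_ell2.rep_eq)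
qed


section \<open>Cocycles from a Foelner sequence\<close>

text \<open>
  A left Foelner sequence with exponentially small boundaries.  The growth condition makes
  \<open>1 / sqrt (card (F k))\<close> at most \<open>2\<^sup>-\<^sup>k\<close>, the same rate as for the boundaries, and forces the group to be
  infinite.
\<close>

locale fast_foelner_sequence =
  fixes F :: "nat \<Rightarrow> 'g::group_add set"
  assumes finite_F: "finite (F k)"
    and card_F: "4 ^ k \<le> card (F k)"
    and almost_invariant:
      "\<exists>C. \<forall>k. real (card (F k - (+) g ` F k)) \<le> C * (1 / 2) ^ k * real (card (F k))"
begin

interpretation banach_group_module "cstar_red :: 'g l2_operator set" scaleC_op translate_op
  by (rule banach_group_module_cstar_red)

lemma card_F_pos: "0 < card (F k)"
  using card_F[of k] by (metis gr0I not_le zero_less_numeral zero_less_power)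

lemma infinite_group: "infinite (UNIV :: 'g set)"
proof
  assume "finite (UNIV :: 'g set)"
  then have "4 ^ k \<le> card (UNIV :: 'g set)" for k
    using card_F[of k] card_mono[of UNIV "F k"] by simp
  from this[of "card (UNIV :: 'g set)"] show False
    using less_exp[of "card (UNIV :: 'g set)"] power_mono[of 2 "4::nat" "card (UNIV :: 'g set)"] by linarith
qed

text \<open>Coefficients for which the series below converge absolutely.\<close>

definition admissible :: "(nat \<Rightarrow> complex) \<Rightarrow> bool" where
  "admissible c \<longleftrightarrow> summable (\<lambda>k. cmod (c k) * (1 / 2) ^ k)"

text \<open>The partial sums of \<open>\<Sum>\<^sub>k c k E k\<close>, where \<open>E k\<close> is the averaging operator of \<open>F k\<close>.\<close>

definition partial_avg :: "(nat \<Rightarrow> complex) \<Rightarrow> nat \<Rightarrow> 'g l2_operator" where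
  "partial_avg c K = (\<Sum>k<K. scaleC_op (c k) (averaging (F k)))"

text \<open>
  The cocycle \<open>g \<mapsto> \<Sum>\<^sub>k c k (g E k - E k)\<close>, a formal coboundary.  It is written as the limit of the
  coboundaries of the partial sums; the value is meaningful for admissible coefficients.
\<close>

definition avg_cocycle :: "(nat \<Rightarrow> complex) \<Rightarrow> 'g \<Rightarrow> 'g l2_operator" where
  "avg_cocycle c g = lim (\<lambda>K. translate_op g (partial_avg c K) - partial_avg c K)"

lemma partial_avg_cstar_red: "partial_avg c K \<in> cstar_red"
  unfolding partial_avg_def by (intro sum_M scale_M averaging_cstar_red)

lemma tendsto_avg_cocycle:
  assumes c: "admissible c"
  shows "(\<lambda>K. translate_op g (partial_avg c K) - partial_avg c K) \<longlonglongrightarrow> avg_cocycle c g"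
proof -
  obtain C where C: "\<And>k. real (card (F k - (+) g ` F k)) \<le> C * (1 / 2) ^ k * real (card (F k))"
    using almost_invariant by blast
  let ?d = "\<lambda>k. scaleC_op (c k) (translate_op g (averaging (F k)) - averaging (F k))"
  have "norm (?d k) \<le> 2 * C * (cmod (c k) * (1 / 2) ^ k)" for k
  proof -
    have "norm (?d k) = cmod (c k) * norm (translate_op g (averaging (F k)) - averaging (F k))"
      by (intro norm_scale diff_M act_M averaging_cstar_red)
    also have "\<dots> \<le> cmod (c k) * (2 * real (card (F k - (+) g ` F k)) / real (card (F k)))"
      by (intro mult_left_mono norm_translate_averaging_le finite_F) simp
    also have "\<dots> \<le> cmod (c k) * (2 * C * (1 / 2) ^ k)"
      using C[of k] card_F_pos[of k] by (intro mult_left_mono) (auto simp: field_simps)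
    finally show ?thesis by (simp add: mult_ac)
  qed
  then have "summable ?d"
    by (rule summable_comparison_test'[OF summable_mult[OF c[unfolded admissible_def]]])
  moreover have "(\<lambda>K. translate_op g (partial_avg c K) - partial_avg c K) = (\<lambda>K. \<Sum>k<K. ?d k)"
  proof
    fix K
    have "translate_op g (partial_avg c K) = (\<Sum>k<K. scaleC_op (c k) (translate_op g (averaging (F k))))"
      unfolding partial_avg_def
      by (simp add: linear_sum[OF bounded_linear.linear[OF bounded_linear_translate_op]]
          act_scale averaging_cstar_red)
    then show "translate_op g (partial_avg c K) - partial_avg c K = (\<Sum>k<K. ?d k)"
      by (simp add: partial_avg_def sum_subtractf scale_diff act_M averaging_cstar_red)
  qed
  ultimately have "convergent (\<lambda>K. translate_op g (partial_avg c K) - partial_avg c K)"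
    by (simp add: summable_iff_convergent)
  then show ?thesis unfolding avg_cocycle_def by (simp add: convergent_LIMSEQ_iff)
qed

lemma avg_cocycle_cocycle: "admissible c \<Longrightarrow> avg_cocycle c \<in> cocycles cstar_red translate_op"
  using coboundary_cocycle coboundaryI[OF partial_avg_cstar_red]
  by (intro cocycle_limit[OF _ tendsto_avg_cocycle]) blast+

lemma avg_cocycle_add:
  assumes "admissible c" "admissible d"
  shows "admissible (\<lambda>k. c k + d k)"
    "avg_cocycle (\<lambda>k. c k + d k) = (\<lambda>g. avg_cocycle c g + avg_cocycle d g)"
proof -
  have "summable (\<lambda>k. cmod (c k) * (1 / 2) ^ k + cmod (d k) * (1 / 2) ^ k)"
    using assms unfolding admissible_def by (rule summable_add)
  then show adm: "admissible (\<lambda>k. c k + d k)"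
    unfolding admissible_def
    by (rule summable_comparison_test')
      (simp add: norm_triangle_ineq mult_right_mono flip: distrib_right)
  have "partial_avg (\<lambda>k. c k + d k) K = partial_avg c K + partial_avg d K" for K
    by (simp add: partial_avg_def scale_add_left averaging_cstar_red sum.distrib)
  then have "(\<lambda>K. translate_op g (partial_avg (\<lambda>k. c k + d k) K) - partial_avg (\<lambda>k. c k + d k) K)
      \<longlonglongrightarrow> avg_cocycle c g + avg_cocycle d g" for g
    using tendsto_add[OF tendsto_avg_cocycle[OF assms(1)] tendsto_avg_cocycle[OF assms(2)], of g g]
    by (simp add: act_add partial_avg_cstar_red algebra_simps)
  then show "avg_cocycle (\<lambda>k. c k + d k) = (\<lambda>g. avg_cocycle c g + avg_cocycle d g)"
    using LIMSEQ_unique[OF tendsto_avg_cocycle[OF adm]] by blast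
qed

lemma avg_cocycle_scale:
  assumes "admissible c"
  shows "admissible (\<lambda>k. a * c k)"
    "avg_cocycle (\<lambda>k. a * c k) = (\<lambda>g. scaleC_op a (avg_cocycle c g))"
proof -
  show adm: "admissible (\<lambda>k. a * c k)"
    using summable_mult[OF assms[unfolded admissible_def], of "cmod a"]
    unfolding admissible_def by (simp add: norm_mult mult.assoc)
  have "partial_avg (\<lambda>k. a * c k) K = scaleC_op a (partial_avg c K)" for K
    by (simp add: partial_avg_def linear_sum[OF bounded_linear.linear[OF bounded_linear_scaleC_op]]
        scale_scale averaging_cstar_red)
  then have "(\<lambda>K. translate_op g (partial_avg (\<lambda>k. a * c k) K) - partial_avg (\<lambda>k. a * c k) K)
      \<longlonglongrightarrow> scaleC_op a (avg_cocycle c g)" for g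
    using bounded_linear.tendsto[OF bounded_linear_scaleC_op tendsto_avg_cocycle[OF assms, of g], of a]
    by (simp add: act_scale scale_diff act_M partial_avg_cstar_red)
  then show "avg_cocycle (\<lambda>k. a * c k) = (\<lambda>g. scaleC_op a (avg_cocycle c g))"
    using LIMSEQ_unique[OF tendsto_avg_cocycle[OF adm]] by blast
qed

lemma partial_avg_apply:
  "partial_avg c K x = (\<Sum>k<K. scaleC_ell2 (c k) (averaging (F k) x))"
  by (simp add: partial_avg_def blinfun.sum_left scaleC_op_apply)

lemma convergent_partial_avg_ind:
  assumes c: "admissible c" and B: "finite B"
  shows "convergent (\<lambda>K. partial_avg c K (ind_ell2 B))"
proof -
  have "norm (scaleC_ell2 (c k) (averaging (F k) (ind_ell2 B)))
      \<le> real (card B) * (cmod (c k) * (1 / 2) ^ k)" for k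
  proof -
    have "2 ^ k = sqrt (4 ^ k)"
      by (simp add: real_sqrt_power)
    also have "\<dots> \<le> sqrt (real (card (F k)))"
      using card_F[of k] by (metis of_nat_le_iff of_nat_numeral of_nat_power real_sqrt_le_iff)
    finally have "real (card B) / sqrt (real (card (F k))) \<le> real (card B) / 2 ^ k"
      by (intro divide_left_mono) (use card_F_pos in auto)
    then have "norm (averaging (F k) (ind_ell2 B)) \<le> real (card B) * (1 / 2) ^ k"
      using norm_averaging_ind_le[OF finite_F B, of k] by (simp add: power_one_over)
    then have "cmod (c k) * norm (averaging (F k) (ind_ell2 B)) \<le> cmod (c k) * (real (card B) * (1 / 2) ^ k)"
      by (intro mult_left_mono) auto
    then show ?thesis by (simp add: norm_scaleC_ell2 mult_ac)
  qed
  then have "summable (\<lambda>k. scaleC_ell2 (c k) (averaging (F k) (ind_ell2 B)))"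
    by (rule summable_comparison_test'[OF summable_mult[OF c[unfolded admissible_def]]])
  then show ?thesis by (simp add: partial_avg_apply summable_iff_convergent)
qed

text \<open>
  An operator with coboundary \<open>avg_cocycle c\<close> is determined on indicator functions of finite sets: it is
  the pointwise sum of \<open>\<Sum>\<^sub>k c k E k\<close> there, even if this series does not converge in norm.
\<close>

lemma partial_avg_ind_tendsto:
  assumes c: "admissible c" and T: "\<And>g. avg_cocycle c g = translate_op g T - T" and B: "finite B"
  shows "(\<lambda>K. partial_avg c K (ind_ell2 B)) \<longlonglongrightarrow> T (ind_ell2 B)"
proof -
  let ?u = "ind_ell2 B"
  obtain v where v: "(\<lambda>K. partial_avg c K ?u) \<longlonglongrightarrow> v"
    using convergent_partial_avg_ind[OF c B] convergent_def by blast
  have "translate g (v - T ?u) = v - T ?u" for g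
  proof -
    have "(\<lambda>K. translate g (partial_avg c K ?u) - partial_avg c K ?u) \<longlonglongrightarrow> translate g v - v"
      by (intro tendsto_diff v bounded_linear.tendsto[OF bounded_linear_translate])
    moreover have "(\<lambda>K. (translate_op g (partial_avg c K) - partial_avg c K) ?u)
        \<longlonglongrightarrow> (translate_op g T - T) ?u"
      unfolding T[symmetric] by (intro tendsto_intros tendsto_avg_cocycle c)
    ultimately have "translate g v - v = translate g (T ?u) - T ?u"
      by (intro LIMSEQ_unique) (simp_all add: blinfun.diff_left translate_op_apply)
    then show ?thesis
      by (simp add: linear_diff[OF bounded_linear.linear[OF bounded_linear_translate]] algebra_simps)
  qed
  then have "v - T ?u = 0" by (rule translation_invariant_ell2_eq_0[OF infinite_group])
  with v show ?thesis by simp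
qed

text \<open>
  The matrix coefficient of the averaging operator of \<open>F k\<close> at the normalized indicator vector of
  \<open>F N\<close>; see \<open>sum_coeff_averaging\<close>.
\<close>

definition overlap :: "nat \<Rightarrow> nat \<Rightarrow> real" where
  "overlap k N = (\<Sum>h\<in>F k. real (card (F N \<inter> (+) h ` F N)) / real (card (F N))) / real (card (F k))"

lemma overlap_nonneg: "0 \<le> overlap k N"
  unfolding overlap_def by (intro divide_nonneg_nonneg sum_nonneg) auto

lemma sum_coeff_averaging:
  "(\<Sum>z\<in>F N. coeff_ell2 (averaging (F k) (ind_ell2 (F N))) z)
    = of_real (overlap k N) * of_nat (card (F N))"
proof -
  have count: "(\<Sum>z\<in>F N. of_bool (- h + z \<in> F N)) = (of_nat (card (F N \<inter> (+) h ` F N)) :: complex)" for h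
  proof -
    have "(- h + z \<in> F N) = (z \<in> (+) h ` F N)" for z
      by (force simp: image_iff add.assoc[symmetric])
    then have "(\<Sum>z\<in>F N. of_bool (- h + z \<in> F N)) = (\<Sum>z\<in>F N. (of_bool (z \<in> (+) h ` F N) :: complex))"
      by simp
    also have "\<dots> = of_nat (card (F N \<inter> (+) h ` F N))"
      using sum.inter_restrict[OF finite_F, of "\<lambda>_. 1::complex" N "(+) h ` F N"] by (simp add: of_bool_def)
    finally show ?thesis .
  qed
  have "(\<Sum>z\<in>F N. coeff_ell2 (averaging (F k) (ind_ell2 (F N))) z)
      = (\<Sum>z\<in>F N. \<Sum>h\<in>F k. of_bool (- h + z \<in> F N)) / of_nat (card (F k))"
    by (simp only: coeff_averaging coeff_ind_ell2[OF finite_F] sum_divide_distrib)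
  also have "(\<Sum>z\<in>F N. \<Sum>h\<in>F k. of_bool (- h + z \<in> F N))
      = (\<Sum>h\<in>F k. \<Sum>z\<in>F N. of_bool (- h + z \<in> F N) :: complex)"
    by (rule sum.swap)
  also have "\<dots> = (\<Sum>h\<in>F k. of_nat (card (F N \<inter> (+) h ` F N)))"
    by (simp only: count)
  finally show ?thesis
    using card_F_pos[of N] by (simp add: overlap_def sum_divide_distrib[symmetric])
qed

lemma overlap_tendsto_1: "overlap k \<longlonglongrightarrow> 1"
proof -
  have "(\<lambda>N. real (card (F N \<inter> (+) h ` F N)) / real (card (F N))) \<longlonglongrightarrow> 1" for h
  proof -
    obtain C where C: "\<And>N. real (card (F N - (+) h ` F N)) \<le> C * (1 / 2) ^ N * real (card (F N))"
      using almost_invariant by blast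
    have "(\<lambda>N. real (card (F N - (+) h ` F N)) / real (card (F N))) \<longlonglongrightarrow> 0"
    proof (rule tendsto_sandwich[OF _ _ tendsto_const])
      show "\<forall>\<^sub>F N in sequentially. real (card (F N - (+) h ` F N)) / real (card (F N)) \<le> C * (1 / 2) ^ N"
        using C card_F_pos by (simp add: divide_le_eq)
      show "(\<lambda>N. C * (1 / 2) ^ N) \<longlonglongrightarrow> 0"
        by (intro tendsto_mult_right_zero LIMSEQ_power_zero) simp
    qed (auto simp: divide_nonneg_nonneg)
    then have "(\<lambda>N. 1 - real (card (F N - (+) h ` F N)) / real (card (F N))) \<longlonglongrightarrow> 1 - 0"
      by (intro tendsto_diff tendsto_const)
    moreover have "1 - real (card (F N - (+) h ` F N)) / real (card (F N))
        = real (card (F N \<inter> (+) h ` F N)) / real (card (F N))" for N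
    proof -
      have "card (F N \<inter> (+) h ` F N) + card (F N - (+) h ` F N) = card (F N)"
        using finite_F[of N] by (subst card_Un_disjoint[symmetric]) (auto intro: arg_cong[where f = card])
      then have "real (card (F N)) = real (card (F N \<inter> (+) h ` F N)) + real (card (F N - (+) h ` F N))"
        by linarith
      then show ?thesis using card_F_pos[of N] by (simp add: field_simps)
    qed
    ultimately show ?thesis by simp
  qed
  then have "overlap k \<longlonglongrightarrow> (\<Sum>h\<in>F k. 1) / real (card (F k))"
    unfolding overlap_def[abs_def] by (intro tendsto_intros) (use card_F_pos[of k] in auto)
  then show ?thesis using card_F_pos[of k] by simp
qed

lemma overlap_series_bound:
  assumes c: "admissible c" and T: "\<And>g. avg_cocycle c g = translate_op g T - T"
  shows "\<exists>l. (\<lambda>K. \<Sum>k<K. c k * of_real (overlap k N)) \<longlonglongrightarrow> l \<and> cmod l \<le> norm T"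
proof -
  let ?u = "ind_ell2 (F N)" and ?n = "real (card (F N))"
  have pos: "0 < ?n" using card_F_pos by simp
  define l where "l = (\<Sum>z\<in>F N. coeff_ell2 (T ?u) z) / of_real ?n"
  have "(\<lambda>K. (\<Sum>z\<in>F N. coeff_ell2 (partial_avg c K ?u) z) / of_real ?n) \<longlonglongrightarrow> l"
    unfolding l_def using pos
    by (intro tendsto_divide tendsto_sum bounded_linear.tendsto[OF bounded_linear_coeff]
        partial_avg_ind_tendsto[OF c T finite_F]) auto
  moreover have "(\<Sum>z\<in>F N. coeff_ell2 (partial_avg c K ?u) z) / of_real ?n
      = (\<Sum>k<K. c k * of_real (overlap k N))" for K
  proof -
    have "(\<Sum>z\<in>F N. coeff_ell2 (partial_avg c K ?u) z)
        = (\<Sum>k<K. c k * (\<Sum>z\<in>F N. coeff_ell2 (averaging (F k) ?u) z))"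
      by (simp add: partial_avg_apply coeff_sum_ell2 scaleC_ell2.rep_eq sum_distrib_left
          sum.swap[of _ "F N"])
    also have "\<dots> = (\<Sum>k<K. c k * of_real (overlap k N)) * of_real ?n"
      by (simp add: sum_coeff_averaging sum_distrib_right mult.assoc)
    finally show ?thesis using pos by simp
  qed
  moreover have "cmod l \<le> norm T"
  proof -
    have "cmod (\<Sum>z\<in>F N. coeff_ell2 (T ?u) z) \<le> sqrt ?n * norm (T ?u)"
      by (rule sum_coeff_le[OF finite_F])
    also have "\<dots> \<le> sqrt ?n * (norm T * sqrt ?n)"
      using norm_blinfun[of T ?u] by (intro mult_left_mono) (auto simp: norm_ind_ell2 finite_F)
    also have "\<dots> = norm T * ?n" by simp
    finally show ?thesis using pos by (simp add: l_def norm_divide divide_le_eq)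
  qed
  ultimately show ?thesis by auto
qed

text \<open>
  For fixed \<open>N\<close> the terms with large \<open>k\<close> have nonnegative real part, so the partial sums up to \<open>m\<close>
  are bounded by \<open>norm T\<close>; letting \<open>N\<close> tend to infinity replaces the overlaps by \<open>1\<close>.
\<close>

lemma avg_cocycle_not_coboundary:
  assumes c: "admissible c" and ev: "eventually (\<lambda>k. 1 \<le> Re (c k)) sequentially"
  shows "avg_cocycle c \<notin> coboundaries cstar_red translate_op"
proof
  assume "avg_cocycle c \<in> coboundaries cstar_red translate_op"
  then obtain T where T: "\<And>g. avg_cocycle c g = translate_op g T - T"
    unfolding coboundaries_def by blast
  obtain k0 where k0: "\<And>k. k0 \<le> k \<Longrightarrow> 1 \<le> Re (c k)"
    using ev unfolding eventually_sequentially by blast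
  have "(\<Sum>k<m. Re (c k) * overlap k N) \<le> norm T" if m: "k0 \<le> m" for m N
  proof -
    obtain l where l: "(\<lambda>K. \<Sum>k<K. c k * of_real (overlap k N)) \<longlonglongrightarrow> l" "cmod l \<le> norm T"
      using overlap_series_bound[OF c T] by blast
    have "(\<lambda>K. \<Sum>k<K. Re (c k) * overlap k N) \<longlonglongrightarrow> Re l"
      using tendsto_Re[OF l(1)] by simp
    moreover have "(\<Sum>k<m. Re (c k) * overlap k N) \<le> (\<Sum>k<K. Re (c k) * overlap k N)" if "m \<le> K" for K
      using that m k0 overlap_nonneg
      by (intro sum_mono2) (auto intro!: mult_nonneg_nonneg intro: order_trans[OF zero_le_one])
    ultimately have "(\<Sum>k<m. Re (c k) * overlap k N) \<le> Re l"
      by (blast intro: LIMSEQ_le_const)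
    with l(2) complex_Re_le_cmod[of l] show ?thesis by linarith
  qed
  moreover have "(\<lambda>N. \<Sum>k<m. Re (c k) * overlap k N) \<longlonglongrightarrow> (\<Sum>k<m. Re (c k) * 1)" for m
    by (intro tendsto_intros overlap_tendsto_1)
  ultimately have bound: "(\<Sum>k<m. Re (c k)) \<le> norm T" if "k0 \<le> m" for m
    using LIMSEQ_le_const2 that by (metis (no_types, lifting) mult.right_neutral sum.cong)
  have grow: "(\<Sum>k<k0. Re (c k)) + real j \<le> (\<Sum>k<k0 + j. Re (c k))" for j
  proof (induction j)
    case (Suc j)
    then show ?case using k0[of "k0 + j"] by simp
  qed simp
  obtain j where "norm T - (\<Sum>k<k0. Re (c k)) < real j" using reals_Archimedean2 by blast
  with grow[of j] bound[of "k0 + j"] show False by simp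
qed


lemma admissible_poly: "admissible (\<lambda>k. poly p (of_nat k))"
proof -
  have "summable (\<lambda>k. \<Sum>i\<le>degree p. cmod (Polynomial.coeff p i) * (real k ^ i * (1 / 2) ^ k))"
  proof (intro summable_sum summable_mult)
    fix i
    have "(\<lambda>k. real k ^ i * (1 / 2) ^ k) \<in> O(\<lambda>k. (3 / 4) ^ k)" by real_asymp
    then show "summable (\<lambda>k. real k ^ i * (1 / 2) ^ k)"
      by (rule summable_comparison_test_bigo[rotated]) (simp add: norm_power)
  qed
  then show ?thesis
    unfolding admissible_def
  proof (rule summable_comparison_test')
    fix k
    have "cmod (poly p (of_nat k)) \<le> (\<Sum>i\<le>degree p. cmod (Polynomial.coeff p i) * real k ^ i)"
      unfolding poly_altdef by (rule sum_norm_le) (simp add: norm_mult norm_power)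
    then have "cmod (poly p (of_nat k)) * (1 / 2) ^ k
        \<le> (\<Sum>i\<le>degree p. cmod (Polynomial.coeff p i) * real k ^ i) * (1 / 2) ^ k"
      by (rule mult_right_mono) simp
    then show "norm (cmod (poly p (of_nat k)) * (1 / 2) ^ k)
        \<le> (\<Sum>i\<le>degree p. cmod (Polynomial.coeff p i) * (real k ^ i * (1 / 2) ^ k))"
      by (simp add: sum_distrib_right mult.assoc)
  qed
qed

lemma poly_cocycle_not_coboundary:
  assumes "p \<noteq> 0"
  shows "avg_cocycle (\<lambda>k. poly p (of_nat k)) \<notin> coboundaries cstar_red translate_op"
proof
  assume cob: "avg_cocycle (\<lambda>k. poly p (of_nat k)) \<in> coboundaries cstar_red translate_op"
  \<comment> \<open>Once the leading coefficient is \<open>1\<close>, the real part of the values is eventually at least \<open>1\<close>.\<close>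
  define q where "q = Polynomial.smult (inverse (lead_coeff p)) p"
  have lead_q: "lead_coeff q = 1" using assms by (simp add: q_def)
  \<comment> \<open>The polynomial whose value at a real argument is the real part of the value of \<open>q\<close>.\<close>
  define r where "r = map_poly Re q"
  have coeff_r: "Polynomial.coeff r i = Re (Polynomial.coeff q i)" for i
    by (simp add: r_def coeff_map_poly)
  have deg: "degree r = degree q"
    using coeff_r lead_q by (intro antisym degree_le le_degree) (auto simp: coeff_eq_0)
  have poly_r: "poly r x = Re (poly q (of_real x))" for x
    by (simp add: poly_altdef deg coeff_r flip: of_real_power)
  obtain x0 where x0: "\<And>x. x0 \<le> x \<Longrightarrow> 1 \<le> poly r x"
    using poly_pinfty_gt_lc[of r] lead_q by (auto simp: deg coeff_r)
  obtain k0 where "x0 \<le> real k0" using real_arch_simple by blast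
  then have "1 \<le> Re (poly q (of_nat k))" if "k0 \<le> k" for k
    using x0[of "real k"] that by (simp add: poly_r)
  then have "avg_cocycle (\<lambda>k. poly q (of_nat k)) \<notin> coboundaries cstar_red translate_op"
    by (intro avg_cocycle_not_coboundary admissible_poly eventually_sequentiallyI)
  moreover have "avg_cocycle (\<lambda>k. poly q (of_nat k))
      = (\<lambda>g. scaleC_op (inverse (lead_coeff p)) (avg_cocycle (\<lambda>k. poly p (of_nat k)) g))"
    using avg_cocycle_scale(2)[OF admissible_poly] by (simp add: q_def)
  ultimately show False using scale_coboundary[OF cob] by simp
qed

theorem H1_not_Hausdorff: "\<not> Hausdorff_space (H1_topology (cstar_red :: 'g l2_operator set) translate_op)"
  using not_Hausdorff_H1[OF coboundaryI[OF partial_avg_cstar_red]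
      tendsto_avg_cocycle[OF admissible_poly] poly_cocycle_not_coboundary[of 1]] by simp

theorem H1_not_fin_dim:
  "\<not> vectorspace.fin_dim class_ring (H1 (cstar_red :: 'g l2_operator set) scaleC_op translate_op)"
proof (rule not_fin_dim_if_poly_embeds[OF vectorspace_H1])
  let ?f = "\<lambda>p. avg_cocycle (\<lambda>k. poly p (of_nat k))"
  let ?\<Phi> = "\<lambda>p. cohomologous cstar_red translate_op `` {?f p}"
  have cocycle: "?f p \<in> cocycles cstar_red translate_op" for p
    by (rule avg_cocycle_cocycle[OF admissible_poly])
  fix p q c
  show "?\<Phi> p \<in> carrier (H1 cstar_red scaleC_op translate_op)"
    using cocycle by (auto simp: H1_carrier)
  show "?\<Phi> (p + q) = ?\<Phi> p \<oplus>\<^bsub>H1 cstar_red scaleC_op translate_op\<^esub> ?\<Phi> q"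
    by (simp add: H1_add cocycle avg_cocycle_add(2) admissible_poly)
  show "?\<Phi> (Polynomial.smult c p) = c \<odot>\<^bsub>H1 cstar_red scaleC_op translate_op\<^esub> ?\<Phi> p"
    by (simp add: H1_smult cocycle avg_cocycle_scale(2) admissible_poly)
  show "p = 0" if "?\<Phi> p = \<zero>\<^bsub>H1 cstar_red scaleC_op translate_op\<^esub>"
    using that cohomologous_zero_iff[OF cocycle] poly_cocycle_not_coboundary
    by (auto simp: H1_zero)
qed

end

section \<open>Boxes in the integer lattice\<close>

lemma card_vec_box:
  fixes S :: "'n::finite \<Rightarrow> 'a set"
  shows "card {x :: 'a ^ 'n. \<forall>i. vec_nth x i \<in> S i} = (\<Prod>i\<in>UNIV. card (S i))"
    and "(\<And>i. finite (S i)) \<Longrightarrow> finite {x :: 'a ^ 'n. \<forall>i. vec_nth x i \<in> S i}"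
proof -
  have eq: "{x :: 'a ^ 'n. \<forall>i. vec_nth x i \<in> S i} = vec_lambda ` PiE UNIV S"
  proof (intro equalityI subsetI)
    fix x :: "'a ^ 'n" assume "x \<in> {x. \<forall>i. vec_nth x i \<in> S i}"
    then show "x \<in> vec_lambda ` PiE UNIV S"
      by (intro image_eqI[of _ _ "vec_nth x"]) auto
  qed auto
  have "inj_on (vec_lambda :: ('n \<Rightarrow> 'a) \<Rightarrow> _) (PiE UNIV S)"
    by (rule inj_onI) (metis vec_lambda_inverse UNIV_I)
  then show "card {x :: 'a ^ 'n. \<forall>i. vec_nth x i \<in> S i} = (\<Prod>i\<in>UNIV. card (S i))"
    unfolding eq by (simp add: card_image card_PiE)
  show "finite {x :: 'a ^ 'n. \<forall>i. vec_nth x i \<in> S i}" if "\<And>i. finite (S i)"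
    unfolding eq using that by (intro finite_imageI finite_PiE) auto
qed

text \<open>The box with side length \<open>4\<^sup>k\<close> and lowest corner at the origin.\<close>

definition box4 :: "nat \<Rightarrow> (int ^ 'n::finite) set" where
  "box4 k = {x. \<forall>i. vec_nth x i \<in> {0..<4 ^ k}}"

lemma card_interval_diff_le: "card ({0..<m} - (+) a ` {0..<m}) \<le> nat \<bar>a\<bar>" for a m :: int
proof -
  have "{0..<m} - (+) a ` {0..<m} \<subseteq> (if 0 \<le> a then {0..<a} else {m + a..<m})"
  proof
    fix x assume x: "x \<in> {0..<m} - (+) a ` {0..<m}"
    have "x - a \<notin> {0..<m}" using x imageI[of "x - a" "{0..<m}" "(+) a"] by auto
    with x show "x \<in> (if 0 \<le> a then {0..<a} else {m + a..<m})" by auto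
  qed
  then have "card ({0..<m} - (+) a ` {0..<m}) \<le> card (if 0 \<le> a then {0..<a} else {m + a..<m})"
    by (intro card_mono) auto
  also have "\<dots> = nat \<bar>a\<bar>" by simp
  finally show ?thesis .
qed

text \<open>
  A point of the box outside its translate by \<open>g\<close> has some coordinate \<open>i\<close> in one of at most \<open>\<bar>g\<^sub>i\<bar>\<close>
  layers of the box.
\<close>

lemma card_box4_diff_le:
  fixes g :: "int ^ 'n::finite"
  shows "real (card (box4 k - (+) g ` box4 k))
    \<le> (\<Sum>i\<in>UNIV. \<bar>real_of_int (vec_nth g i)\<bar>) / 4 ^ k * real (card (box4 k :: (int ^ 'n) set))"
proof -
  let ?I = "{0..<4 ^ k :: int}"
  let ?D = "\<lambda>i. ?I - (+) (vec_nth g i) ` ?I"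
  let ?slab = "\<lambda>i. {x :: int ^ 'n. \<forall>j. vec_nth x j \<in> (if j = i then ?D i else ?I)}"
  have "box4 k - (+) g ` box4 k \<subseteq> (\<Union>i. ?slab i)"
  proof
    fix x assume x: "x \<in> box4 k - (+) g ` box4 k"
    then have "x - g \<notin> box4 k" by (metis DiffD2 add_diff_cancel_left' diff_add_cancel add.commute imageI)
    then obtain i where i: "vec_nth (x - g) i \<notin> ?I" unfolding box4_def by blast
    have "vec_nth x i \<in> ?D i" using x i by (auto simp: box4_def)
    moreover have "vec_nth x j \<in> ?I" for j using x by (simp add: box4_def)
    ultimately have "x \<in> ?slab i" by auto
    then show "x \<in> (\<Union>i. ?slab i)" by blast
  qed
  then have "card (box4 k - (+) g ` box4 k) \<le> card (\<Union>i. ?slab i)"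
    by (intro card_mono finite_UN_I card_vec_box(2)) auto
  also have "\<dots> \<le> (\<Sum>i\<in>UNIV. card (?slab i))" by (intro card_UN_le) simp
  finally have "real (card (box4 k - (+) g ` box4 k)) \<le> (\<Sum>i\<in>UNIV. real (card (?slab i)))"
    by (simp flip: of_nat_sum)
  also have "\<dots> \<le> (\<Sum>i\<in>UNIV. \<bar>real_of_int (vec_nth g i)\<bar> / 4 ^ k * real (card (box4 k :: (int ^ 'n) set)))"
  proof (rule sum_mono)
    fix i :: 'n
    let ?P = "\<Prod>j\<in>UNIV - {i}. card ?I"
    have slab: "card (?slab i) = card (?D i) * ?P"
      unfolding card_vec_box by (subst prod.remove[of _ i]) auto
    have box: "card (box4 k :: (int ^ 'n) set) = 4 ^ k * ?P"
      unfolding box4_def card_vec_box by (subst prod.remove[of _ i]) auto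
    have "real (card (?D i)) \<le> \<bar>real_of_int (vec_nth g i)\<bar>"
      using card_interval_diff_le[of "4 ^ k" "vec_nth g i"] by linarith
    then have "real (card (?D i)) * real ?P \<le> \<bar>real_of_int (vec_nth g i)\<bar> * real ?P"
      by (rule mult_right_mono) simp
    then show "real (card (?slab i))
        \<le> \<bar>real_of_int (vec_nth g i)\<bar> / 4 ^ k * real (card (box4 k :: (int ^ 'n) set))"
      unfolding slab box by simp
  qed
  finally show ?thesis by (simp only: sum_distrib_right sum_divide_distrib)
qed

lemma fast_foelner_box4: "fast_foelner_sequence (box4 :: nat \<Rightarrow> (int ^ 'n::finite) set)"
proof
  fix k and g :: "int ^ 'n"
  show "finite (box4 k :: (int ^ 'n) set)"
    unfolding box4_def by (rule card_vec_box(2)) simp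
  have "card (box4 k :: (int ^ 'n) set) = (4 ^ k) ^ CARD('n)"
    unfolding box4_def card_vec_box by (simp add: nat_power_eq)
  then show "4 ^ k \<le> card (box4 k :: (int ^ 'n) set)"
    using self_le_power[of "4 ^ k :: nat" "CARD('n)"] by simp
  let ?C = "\<Sum>i\<in>UNIV. \<bar>real_of_int (vec_nth g i)\<bar>"
  show "\<exists>C. \<forall>k. real (card (box4 k - (+) g ` box4 k)) \<le> C * (1 / 2) ^ k * real (card (box4 k :: (int ^ 'n) set))"
  proof (intro exI[of _ ?C] allI)
    fix k
    have "?C / 4 ^ k \<le> ?C / 2 ^ k"
      by (intro divide_left_mono sum_nonneg power_mono) auto
    then have "?C / 4 ^ k * real (card (box4 k :: (int ^ 'n) set)) \<le> ?C * (1 / 2) ^ k * real (card (box4 k :: (int ^ 'n) set))"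
      by (intro mult_right_mono) (auto simp: power_one_over)
    with card_box4_diff_le[of k g]
    show "real (card (box4 k - (+) g ` box4 k)) \<le> ?C * (1 / 2) ^ k * real (card (box4 k :: (int ^ 'n) set))"
      by linarith
  qed
qed

theorem theorem5:
  shows "\<not> Hausdorff_space
      (H1_topology (cstar_red :: (int ^ 'n::finite) l2_operator set) translate_op) \<and>
    \<not> vectorspace.fin_dim class_ring
      (H1 (cstar_red :: (int ^ 'n) l2_operator set) scaleC_op translate_op)"
  using fast_foelner_sequence.H1_not_Hausdorff[OF fast_foelner_box4]
    fast_foelner_sequence.H1_not_fin_dim[OF fast_foelner_box4] by blast

end
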